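(* Let $\mathbf E$ be an $n$-dimensional nilpotent evolution algebra of maximal nilindex in the normal form given in the context, with obstruction index $i_0$. Let $\mathcal V_0^{\mathrm{ord}}=\mathcal V_0$ be the set of linear maps $T$ of the form $T(\mathbf e_i)=c_i\mathbf e_n$ $(1\le i\le n)$ with $c_1,\dots,c_n\in\mathbb K$. For each $k\in\{i_0+1,\dots,n-1\}$ let $\mathcal W_k$ be the set of linear maps $S^{(k)}_{\alpha,\mathbf c}$, $\alpha\in\mathbb K^\times$, $\mathbf c=(c_1,\dots,c_k)\in\mathbb K^k$, defined by $$S^{(k)}_{\alpha,\mathbf c}(\mathbf e_i)=\begin{cases} c_i\mathbf e_n, & 1\le i<k,\\ 2^{n-k}\alpha\,\mathbf e_k+c_k\mathbf e_n, & i=k,\\ 2^{n-i}\alpha\,\mathbf e_i, & k<i<n,\\ \alpha\,\mathbf e_n, & i=n.\end{cases}$$ Then the ordinary Rota--Baxter operators of weight zero form the subset $$\mathrm{RB}_0(\mathbf E)=\mathcal V_0^{\mathrm{ord}}\ \sqcup\ \bigcup_{k=i_0+1}^{n-1}\mathcal W_k$$ of $\mathrm{LRB}_0(\mathbf E)$. Hence $$\dim\mathrm{RB}_0(\mathbf E)=\max\{n,\;k+1:\ i_0+1\le k\le n-1\}=n,$$ whereas $\dim\mathrm{LRB}_0(\mathbf E)=n+1$. Thus the local parameter space is one dimension larger than the ordinary one.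
   Context: $\mathbb K$ is a field of characteristic zero and $n\ge 3$. An evolution algebra is an algebra with a basis $\{\mathbf e_1,\dots,\mathbf e_n\}$ (a natural basis) such that $\mathbf e_i\mathbf e_j=0$ for $i\ne j$. Every $n$-dimensional nilpotent evolution algebra of maximal nilindex over $\mathbb K$ admits a natural basis with $$\mathbf e_i^2=\mathbf e_{i+1}+\sum_{j=i+2}^{n-1}a_{ij}\mathbf e_j\ (1\le i\le n-3),\quad \mathbf e_{n-2}^2=\mathbf e_{n-1},\quad \mathbf e_{n-1}^2=\mathbf e_n,\quad \mathbf e_n^2=0,$$ with $a_{ij}\in\mathbb K$; $\mathbf E$ denotes such an algebra with this fixed basis (the normal form). Put $\mathcal I_A=\{(i,j): i+1<j<n,\ a_{ij}\ne0\}$, and define the obstruction index $i_0=0$ if $\mathcal I_A=\varnothing$, and $i_0=\max\{i:(i,j)\in\mathcal I_A\text{ for some }j\}$ otherwise. A linear map $R:\mathbf E\to\mathbf E$ is a Rota--Baxter operator of weight $0$ (also called ordinary) if $R(x)R(y)=R(R(x)y+xR(y))$ for all $x,y\in\mathbf E$; the set of these is $\mathrm{RB}_0(\mathbf E)$. A linear map $T:\mathbf E\to\mathbf E$ is a local Rota--Baxter operator of weight $0$ if for every $x\in\mathbf E$ there is $R_x\in\mathrm{RB}_0(\mathbf E)$ with $T(x)=R_x(x)$; the set of these is $\mathrm{LRB}_0(\mathbf E)$. Both sets are regarded as subsets of $\mathrm{End}(\mathbf E)\cong\mathbb K^{n^2}$ with the Zariski topology; $\dim$ is the Zariski (Krull)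 dimension. $\mathbb K^\times=\mathbb K\setminus\{0\}$. *)

theory Defs
  imports "HOL-Analysis.Abstract_Topology" "HOL-Library.Extended_Nat" "HOL-Library.FuncSet"
begin

section \<open>Zariski topology on affine space and Krull dimension\<close>

text \<open>Affine space over the field \<open>'a\<close> with coordinates indexed by \<open>I\<close> is the set
  \<open>I \<rightarrow>\<^sub>E UNIV\<close> of extensional functions, i.e. of \<open>'a\<close>-rational points; the field
  need not be algebraically closed.\<close>

inductive_set poly_funs :: "'i set \<Rightarrow> (('i \<Rightarrow> 'a::comm_ring_1) \<Rightarrow> 'a) set" for I :: "'i set" where
  const: "(\<lambda>_. c) \<in> poly_funs I"
| coord: "i \<in> I \<Longrightarrow> (\<lambda>x. x i) \<in> poly_funs I"
| add: "p \<in> poly_funs I \<Longrightarrow> q \<in> poly_funs I \<Longrightarrow> (\<lambda>x. p x + q x) \<in> poly_funs I"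
| mult: "p \<in> poly_funs I \<Longrightarrow> q \<in> poly_funs I \<Longrightarrow> (\<lambda>x. p x * q x) \<in> poly_funs I"

definition zero_locus :: "'i set \<Rightarrow> (('i \<Rightarrow> 'a::comm_ring_1) \<Rightarrow> 'a) set \<Rightarrow> ('i \<Rightarrow> 'a) set" where
  "zero_locus I P = {x \<in> I \<rightarrow>\<^sub>E UNIV. \<forall>p\<in>P. p x = 0}"

definition zariski :: "'i set \<Rightarrow> ('i \<Rightarrow> 'a::idom) topology" where
  "zariski I = topology (\<lambda>U. \<exists>P \<subseteq> poly_funs I. U = (I \<rightarrow>\<^sub>E UNIV) - zero_locus I P)"

lemma istopology_zariski:
  fixes I :: "'i set"
  shows "istopology (\<lambda>U. \<exists>P \<subseteq> poly_funs I. U = (I \<rightarrow>\<^sub>E (UNIV :: 'a::idom set)) - zero_locus I P)"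
  (is "istopology ?open")
  unfolding istopology_def
proof (intro conjI allI impI)
  fix S T :: "('i \<Rightarrow> 'a) set"
  assume "?open S" "?open T"
  then obtain P Q where P: "P \<subseteq> poly_funs I" "S = (I \<rightarrow>\<^sub>E UNIV) - zero_locus I P"
    and Q: "Q \<subseteq> poly_funs I" "T = (I \<rightarrow>\<^sub>E UNIV) - zero_locus I Q" by blast
  let ?R = "{(\<lambda>x. p x * q x) | p q. p \<in> P \<and> q \<in> Q}"
  have "?R \<subseteq> poly_funs I" using P(1) Q(1) by (auto intro: poly_funs.mult)
  moreover have "S \<inter> T = (I \<rightarrow>\<^sub>E UNIV) - zero_locus I ?R"
    unfolding P(2) Q(2) zero_locus_def by fastforce
  ultimately show "?open (S \<inter> T)" by blast
next
  fix K :: "('i \<Rightarrow> 'a) set set"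
  assume "\<forall>S\<in>K. ?open S"
  then obtain P where P: "\<And>S. S \<in> K \<Longrightarrow> P S \<subseteq> poly_funs I"
    "\<And>S. S \<in> K \<Longrightarrow> S = (I \<rightarrow>\<^sub>E UNIV) - zero_locus I (P S)" by metis
  have "\<Union>K = (I \<rightarrow>\<^sub>E UNIV) - zero_locus I (\<Union>S\<in>K. P S)"
  proof (intro set_eqI iffI)
    fix x assume "x \<in> \<Union>K"
    then obtain S where "S \<in> K" "x \<in> S" by blast
    then show "x \<in> (I \<rightarrow>\<^sub>E UNIV) - zero_locus I (\<Union>S\<in>K. P S)"
      using P(2)[of S] unfolding zero_locus_def by blast
  next
    fix x assume "x \<in> (I \<rightarrow>\<^sub>E UNIV) - zero_locus I (\<Union>S\<in>K. P S)"
    then obtain S where S: "S \<in> K" "x \<in> (I \<rightarrow>\<^sub>E UNIV) - zero_locus I (P S)"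
      unfolding zero_locus_def by blast
    then show "x \<in> \<Union>K" using P(2)[of S] by blast
  qed
  moreover have "(\<Union>S\<in>K. P S) \<subseteq> poly_funs I" using P(1) by blast
  ultimately show "?open (\<Union>K)" by blast
qed

lemma openin_zariski:
  "openin (zariski I) U \<longleftrightarrow> (\<exists>P \<subseteq> poly_funs I. U = (I \<rightarrow>\<^sub>E UNIV) - zero_locus I P)"
  unfolding zariski_def by (simp add: topology_inverse'[OF istopology_zariski])

lemma topspace_zariski: "topspace (zariski I :: ('i \<Rightarrow> 'a::idom) topology) = I \<rightarrow>\<^sub>E UNIV"
proof
  show "topspace (zariski I :: ('i \<Rightarrow> 'a) topology) \<subseteq> I \<rightarrow>\<^sub>E UNIV"
    unfolding topspace_def openin_zariski by blast
  have "{\<lambda>_. 1 :: 'a} \<subseteq> poly_funs I" by (auto intro: poly_funs.const)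
  then have "openin (zariski I :: ('i \<Rightarrow> 'a) topology) (I \<rightarrow>\<^sub>E UNIV)"
    unfolding openin_zariski zero_locus_def by (intro exI[of _ "{\<lambda>_. 1}"]) auto
  then show "I \<rightarrow>\<^sub>E UNIV \<subseteq> topspace (zariski I :: ('i \<Rightarrow> 'a) topology)"
    by (rule openin_subset)
qed

lemma closedin_zariski:
  fixes Z :: "('i \<Rightarrow> 'a::idom) set"
  shows "closedin (zariski I) Z \<longleftrightarrow> (\<exists>P \<subseteq> poly_funs I. Z = zero_locus I P)"
proof -
  have sub: "zero_locus I P \<subseteq> I \<rightarrow>\<^sub>E UNIV" for P :: "(('i \<Rightarrow> 'a) \<Rightarrow> 'a) set"
    by (auto simp: zero_locus_def)
  have "(I \<rightarrow>\<^sub>E UNIV) - Z = (I \<rightarrow>\<^sub>E UNIV) - zero_locus I P \<longleftrightarrow> Z = zero_locus I P"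
    if "Z \<subseteq> I \<rightarrow>\<^sub>E UNIV" for P
    using that sub[of P] by blast
  then show ?thesis
    unfolding closedin_def topspace_zariski openin_zariski using sub by metis
qed

definition irreducible_in :: "'b topology \<Rightarrow> 'b set \<Rightarrow> bool" where
  "irreducible_in X Z \<longleftrightarrow> Z \<noteq> {} \<and> Z \<subseteq> topspace X \<and>
     (\<forall>A B. closedin X A \<and> closedin X B \<and> Z \<subseteq> A \<union> B \<longrightarrow> Z \<subseteq> A \<or> Z \<subseteq> B)"

text \<open>The supremum of the lengths \<open>d\<close> of chains \<open>Z\<^sub>0 \<subset> \<dots> \<subset> Z\<^sub>d\<close> of irreducible closed sets.
  Since values are in \<^typ>\<open>enat\<close>, the empty space gets dimension 0.\<close>

definition krull_dim :: "'b topology \<Rightarrow> enat" where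
  "krull_dim X = Sup {enat d | d. \<exists>Z :: nat \<Rightarrow> 'b set.
     (\<forall>i\<le>d. closedin X (Z i) \<and> irreducible_in X (Z i)) \<and> (\<forall>i<d. Z i \<subset> Z (Suc i))}"


section \<open>Evolution algebras in normal form\<close>

text \<open>Algebras are not assumed associative, commutative or unital.\<close>

locale nonassoc_algebra = vector_space scale
  for scale :: "'a::field \<Rightarrow> 'v::ab_group_add \<Rightarrow> 'v" (infixr \<open>*s\<close> 75) +
  fixes mul :: "'v \<Rightarrow> 'v \<Rightarrow> 'v" (infixl \<open>\<bullet>\<close> 70)
  assumes linear_mul_right: "Vector_Spaces.linear scale scale (\<lambda>y. x \<bullet> y)"
    and linear_mul_left: "Vector_Spaces.linear scale scale (\<lambda>x. x \<bullet> y)"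

locale evolution_algebra = nonassoc_algebra scale mul
  for scale :: "'a::field \<Rightarrow> 'v::ab_group_add \<Rightarrow> 'v" (infixr \<open>*s\<close> 75)
    and mul :: "'v \<Rightarrow> 'v \<Rightarrow> 'v" (infixl \<open>\<bullet>\<close> 70) +
  fixes n :: nat and e :: "nat \<Rightarrow> 'v"
  assumes basis_inj: "inj_on e {1..n}"
    and basis_independent: "independent (e ` {1..n})"
    and basis_span: "span (e ` {1..n}) = UNIV"
    and natural_basis: "\<lbrakk>i \<in> {1..n}; j \<in> {1..n}; i \<noteq> j\<rbrakk> \<Longrightarrow> e i \<bullet> e j = 0"

text \<open>An algebra with a basis satisfying these relations is automatically nilpotent of maximal
  nilindex. Only the values \<open>a i j\<close> with \<open>1 \<le> i\<close> and \<open>i + 1 < j < n\<close> are relevant.\<close>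

locale max_nilindex_normal_form = evolution_algebra scale mul n e
  for scale :: "'a::field_char_0 \<Rightarrow> 'v::ab_group_add \<Rightarrow> 'v" (infixr \<open>*s\<close> 75)
    and mul :: "'v \<Rightarrow> 'v \<Rightarrow> 'v" (infixl \<open>\<bullet>\<close> 70)
    and n :: nat and e :: "nat \<Rightarrow> 'v" +
  fixes a :: "nat \<Rightarrow> nat \<Rightarrow> 'a"
  assumes n_ge_3: "n \<ge> 3"
    and square: "\<lbrakk>1 \<le> i; i \<le> n - 3\<rbrakk> \<Longrightarrow>
      e i \<bullet> e i = e (i + 1) + (\<Sum>j = i + 2..n - 1. a i j *s e j)"
    and square_n_minus_2: "e (n - 2) \<bullet> e (n - 2) = e (n - 1)"
    and square_n_minus_1: "e (n - 1) \<bullet> e (n - 1) = e n"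
    and square_n: "e n \<bullet> e n = 0"

definition obstruction_set :: "nat \<Rightarrow> (nat \<Rightarrow> nat \<Rightarrow> 'a::zero) \<Rightarrow> (nat \<times> nat) set" where
  "obstruction_set n a = {(i, j). 1 \<le> i \<and> i + 1 < j \<and> j < n \<and> a i j \<noteq> 0}"

definition obstruction_index :: "nat \<Rightarrow> (nat \<Rightarrow> nat \<Rightarrow> 'a::zero) \<Rightarrow> nat" where
  "obstruction_index n a =
     (if obstruction_set n a = {} then 0 else Max {i. \<exists>j. (i, j) \<in> obstruction_set n a})"


section \<open>Rota--Baxter operators of weight zero\<close>

definition RB0 :: "('a::field \<Rightarrow> 'v::ab_group_add \<Rightarrow> 'v) \<Rightarrow> ('v \<Rightarrow> 'v \<Rightarrow> 'v) \<Rightarrow> ('v \<Rightarrow> 'v) set" where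
  "RB0 scale mul = {R. Vector_Spaces.linear scale scale R \<and>
     (\<forall>x y. mul (R x) (R y) = R (mul (R x) y + mul x (R y)))}"

definition LRB0 :: "('a::field \<Rightarrow> 'v::ab_group_add \<Rightarrow> 'v) \<Rightarrow> ('v \<Rightarrow> 'v \<Rightarrow> 'v) \<Rightarrow> ('v \<Rightarrow> 'v) set" where
  "LRB0 scale mul = {T. Vector_Spaces.linear scale scale T \<and>
     (\<forall>x. \<exists>R \<in> RB0 scale mul. T x = R x)}"

definition V0 :: "('a::field \<Rightarrow> 'v::ab_group_add \<Rightarrow> 'v) \<Rightarrow> nat \<Rightarrow> (nat \<Rightarrow> 'v) \<Rightarrow> ('v \<Rightarrow> 'v) set" where
  "V0 scale n e = {T. Vector_Spaces.linear scale scale T \<and>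
     (\<exists>c :: nat \<Rightarrow> 'a. \<forall>i\<in>{1..n}. T (e i) = scale (c i) (e n))}"

definition W :: "('a::field \<Rightarrow> 'v::ab_group_add \<Rightarrow> 'v) \<Rightarrow> nat \<Rightarrow> (nat \<Rightarrow> 'v) \<Rightarrow> nat \<Rightarrow> ('v \<Rightarrow> 'v) set" where
  "W scale n e k = {S. Vector_Spaces.linear scale scale S \<and>
     (\<exists>(\<alpha> :: 'a) (c :: nat \<Rightarrow> 'a). \<alpha> \<noteq> 0 \<and> (\<forall>i\<in>{1..n}. S (e i) =
        (if i < k then scale (c i) (e n)
         else if i = k then scale (2 ^ (n - k) * \<alpha>) (e k) + scale (c k) (e n)
         else if i < n then scale (2 ^ (n - i) * \<alpha>) (e i)
         else scale \<alpha> (e n))))}"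

text \<open>The identification of the endomorphisms with \<open>n\<^sup>2\<close>-dimensional affine space by matrix entries
  with respect to \<open>e\<close>, and the Krull dimension of a set of endomorphisms in the subspace topology.\<close>

definition matrix_entries ::
    "('a::field \<Rightarrow> 'v::ab_group_add \<Rightarrow> 'v) \<Rightarrow> nat \<Rightarrow> (nat \<Rightarrow> 'v) \<Rightarrow> ('v \<Rightarrow> 'v) \<Rightarrow> nat \<times> nat \<Rightarrow> 'a" where
  "matrix_entries scale n e T =
     (\<lambda>(i, j) \<in> {1..n} \<times> {1..n}. module.representation scale (e ` {1..n}) (T (e j)) (e i))"

definition zariski_dim ::
    "('a::field \<Rightarrow> 'v::ab_group_add \<Rightarrow> 'v) \<Rightarrow> nat \<Rightarrow> (nat \<Rightarrow> 'v) \<Rightarrow> ('v \<Rightarrow> 'v) set \<Rightarrow> enat" where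
  "zariski_dim scale n e A =
     krull_dim (subtopology (zariski ({1..n} \<times> {1..n})) (matrix_entries scale n e ` A))"

end

theory Submission
  imports Defs "HOL-Computational_Algebra.Polynomial"
begin

text \<open>
The classification of ordinary operators is a downward induction over the columns of the matrix.
Since \<open>e i \<bullet> e i\<close> starts with \<open>e (i + 1)\<close>, the squares of the basis vectors are unitriangular, and the
identity for the pairs of basis vectors determines each column from the later ones
(\<open>rigid_column_step\<close>): up to entries in the last row the matrix is diagonal, and a
nonzero diagonal entry is twice the next one. A nonzero structure constant in a row with a nonzero
diagonal entry would compare two diagonal entries whose quotient is a power of two other than two,
which is impossible in characteristic zero. This produces the families \<open>V0\<close> and \<open>W k\<close>, with \<open>k\<close>
beyond the obstruction index. The part of \<open>W k\<close> missing from its closure, where the eigenvalue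
\<open>\<alpha>\<close> is zero, lies in \<open>V0\<close>. Hence the ordinary operators form a finite union of linear subspaces
of dimensions \<open>k + 1\<close> and \<open>n\<close> (\<open>RB0_iff_ordinary_shape\<close>).

A local operator has to agree with some ordinary operator at one vector at a time. Testing it on
\<open>e j\<close> and \<open>e i + e j\<close> shows that it has the same diagonal shape except for the last row, which is no longer
constrained: at a given vector a single free entry in the last row of an ordinary operator can
produce any last coordinate. The eigenvalue sequence and the last row are independent parameters, so
the local operators are a finite union of linear subspaces of dimension \<open>n + 1\<close>
(\<open>LRB0_iff_local_shape\<close>).

It remains to know that a linear subspace has the expected Krull dimension, in
terms of points with coordinates in the field itself. Coordinate subspaces give chains of the
expected length; they are irreducible because a polynomial restricted to a line is a univariate
polynomial over an infinite field. For the upper bound, a chain of irreducible closed sets yields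
functions, each vanishing on one set of the chain but not on the next one. These functions satisfy no
polynomial relation (\<open>chain_functions_algebraically_independent\<close>), while a count of monomials shows
that more polynomial functions than variables always satisfy one
(\<open>poly_funs_algebraically_dependent\<close>).
\<close>

section \<open>Algebraic dependence of polynomial functions\<close>

text \<open>Gaussian elimination: a row with a nonzero pivot expresses one unknown through the others, which
removes one equation and one unknown; a zero row may simply be dropped.\<close>
lemma underdetermined_system_has_solution:
  fixes A :: "'m \<Rightarrow> 't \<Rightarrow> 'a::field"
  assumes "finite T" "finite M" "card T < card M"
  shows "\<exists>q. (\<exists>m\<in>M. q m \<noteq> 0) \<and> (\<forall>t\<in>T. (\<Sum>m\<in>M. q m * A m t) = 0)"
  using assms
proof (induction T arbitrary: M A rule: finite_induct)
  case empty
  then have "M \<noteq> {}" by auto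
  then show ?case by (intro exI[of _ "\<lambda>_. 1"]) auto
next
  case (insert t T)
  show ?case
  proof (cases "\<forall>m\<in>M. A m t = 0")
    case True
    have "card T < card M" using insert.hyps insert.prems by simp
    from insert.IH[OF insert.prems(1) this, of A] True show ?thesis by auto
  next
    case False
    then obtain m0 where m0: "m0 \<in> M" "A m0 t \<noteq> 0" by blast
    define M' where "M' = M - {m0}"
    define B where "B m s = A m s - A m t / A m0 t * A m0 s" for m s
    have M': "finite M'" "card T < card M'"
      using insert.hyps insert.prems m0 by (auto simp: M'_def)
    from insert.IH[OF M', of B] obtain q where q: "\<exists>m\<in>M'. q m \<noteq> 0"
      "\<And>s. s \<in> T \<Longrightarrow> (\<Sum>m\<in>M'. q m * B m s) = 0" by blast
    define c where "c = - (\<Sum>m\<in>M'. q m * A m t) / A m0 t"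
    define r where "r m = (if m = m0 then c else q m)" for m
    have split: "(\<Sum>m\<in>M. r m * A m s) = c * A m0 s + (\<Sum>m\<in>M'. q m * A m s)" for s
    proof -
      have "(\<Sum>m\<in>M. r m * A m s) = r m0 * A m0 s + (\<Sum>m\<in>M'. r m * A m s)"
        unfolding M'_def using insert.prems(1) m0(1) by (rule sum.remove)
      also have "(\<Sum>m\<in>M'. r m * A m s) = (\<Sum>m\<in>M'. q m * A m s)"
        by (rule sum.cong) (auto simp: r_def M'_def)
      finally show ?thesis by (simp add: r_def)
    qed
    have "(\<Sum>m\<in>M. r m * A m s) = 0" if "s \<in> T" for s
    proof -
      have "(\<Sum>m\<in>M'. q m * B m s)
          = (\<Sum>m\<in>M'. q m * A m s) - (\<Sum>m\<in>M'. q m * A m t * (A m0 s / A m0 t))"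
        by (simp add: B_def right_diff_distrib sum_subtractf mult.assoc)
      also have "\<dots> = (\<Sum>m\<in>M'. q m * A m s) - (\<Sum>m\<in>M'. q m * A m t) * (A m0 s / A m0 t)"
        by (simp only: sum_distrib_right)
      also have "\<dots> = (\<Sum>m\<in>M. r m * A m s)"
        unfolding split c_def by simp
      finally show ?thesis using q(2)[OF that] by simp
    qed
    moreover have "(\<Sum>m\<in>M. r m * A m t) = 0"
      unfolding split c_def using m0(2) by simp
    moreover have "\<exists>m\<in>M. r m \<noteq> 0"
      using q(1) by (auto simp: r_def M'_def)
    ultimately show ?thesis by blast
  qed
qed

text \<open>The coefficients are indexed by the functions in \<open>T\<close> themselves, so that \<open>lin_comb T\<close> is the span
of \<open>T\<close> when \<open>T\<close> is finite.\<close>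
definition lin_comb :: "('x \<Rightarrow> 'a::comm_ring_1) set \<Rightarrow> ('x \<Rightarrow> 'a) set" where
  "lin_comb T = {f. \<exists>A. f = (\<lambda>x. \<Sum>w\<in>T. A w * w x)}"

lemma lin_comb_add: "f \<in> lin_comb T \<Longrightarrow> g \<in> lin_comb T \<Longrightarrow> (\<lambda>x. f x + g x) \<in> lin_comb T"
proof -
  assume "f \<in> lin_comb T" "g \<in> lin_comb T"
  then obtain A B where "f = (\<lambda>x. \<Sum>w\<in>T. A w * w x)" "g = (\<lambda>x. \<Sum>w\<in>T. B w * w x)"
    by (auto simp: lin_comb_def)
  then have "(\<lambda>x. f x + g x) = (\<lambda>x. \<Sum>w\<in>T. (A w + B w) * w x)"
    by (simp add: distrib_right sum.distrib)
  then show ?thesis unfolding lin_comb_def by (intro CollectI exI[of _ "\<lambda>w. A w + B w"])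
qed

lemma lin_comb_scale: "f \<in> lin_comb T \<Longrightarrow> (\<lambda>x. c * f x) \<in> lin_comb T"
proof -
  assume "f \<in> lin_comb T"
  then obtain A where "f = (\<lambda>x. \<Sum>w\<in>T. A w * w x)" by (auto simp: lin_comb_def)
  then have "(\<lambda>x. c * f x) = (\<lambda>x. \<Sum>w\<in>T. (c * A w) * w x)"
    by (simp add: sum_distrib_left mult.assoc)
  then show ?thesis unfolding lin_comb_def by (intro CollectI exI[of _ "\<lambda>w. c * A w"])
qed

lemma lin_comb_sum:
  "(\<And>s. s \<in> S \<Longrightarrow> f s \<in> lin_comb T) \<Longrightarrow> (\<lambda>x. \<Sum>s\<in>S. f s x) \<in> lin_comb T"
proof (induction S rule: infinite_finite_induct)
  case (insert s S)
  then show ?case using lin_comb_add[of "f s" T "\<lambda>x. \<Sum>s\<in>S. f s x"] by simp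
qed (auto simp: lin_comb_def intro!: exI[of _ "\<lambda>_. 0"])

lemma lin_comb_base:
  assumes "finite T" "w \<in> T"
  shows "w \<in> lin_comb T"
proof -
  have "w x = (\<Sum>v\<in>T. (if v = w then 1 else 0) * v x)" for x
  proof -
    have "(\<Sum>v\<in>T. (if v = w then 1 else 0) * v x) = (\<Sum>v\<in>T. if v = w then v x else 0)"
      by (rule sum.cong) auto
    then show ?thesis using assms by simp
  qed
  then have "w = (\<lambda>x. \<Sum>v\<in>T. (if v = w then 1 else 0) * v x)" by (rule ext)
  then show ?thesis unfolding lin_comb_def by (intro CollectI exI[of _ "\<lambda>v. if v = w then 1 else 0"])
qed

text \<open>The exponent of each single variable, not the total degree, is bounded by \<open>D\<close>. This makes the
number of monomials trivial to bound, and only its growth rate in \<open>D\<close> matters.\<close>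
definition monomials :: "'i set \<Rightarrow> nat \<Rightarrow> (('i \<Rightarrow> 'a::comm_ring_1) \<Rightarrow> 'a) set" where
  "monomials J D = (\<lambda>m x. \<Prod>j\<in>J. x j ^ m j) ` (J \<rightarrow>\<^sub>E {..D})"

lemma monomialsI:
  assumes "\<And>j. j \<in> J \<Longrightarrow> m j \<le> D"
  shows "(\<lambda>x. \<Prod>j\<in>J. x j ^ m j) \<in> monomials J D"
proof -
  have "(\<lambda>x. \<Prod>j\<in>J. x j ^ m j) = (\<lambda>x. \<Prod>j\<in>J. x j ^ restrict m J j)" by simp
  then show ?thesis unfolding monomials_def using assms by (intro image_eqI[of _ _ "restrict m J"]) auto
qed

lemma finite_monomials: "finite J \<Longrightarrow> finite (monomials J D)"
  by (simp add: monomials_def finite_PiE)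

lemma card_monomials_le: "finite J \<Longrightarrow> card (monomials J D) \<le> (D + 1) ^ card J"
  unfolding monomials_def
  by (rule order.trans[OF card_image_le]) (simp_all add: finite_PiE card_PiE)

lemma monomials_mult:
  assumes "v \<in> monomials J D" "w \<in> monomials J D'"
  shows "(\<lambda>x. v x * w x) \<in> monomials J (D + D')"
proof -
  from assms obtain m m' where m: "v = (\<lambda>x. \<Prod>j\<in>J. x j ^ m j)" "m \<in> J \<rightarrow>\<^sub>E {..D}"
    and m': "w = (\<lambda>x. \<Prod>j\<in>J. x j ^ m' j)" "m' \<in> J \<rightarrow>\<^sub>E {..D'}"
    unfolding monomials_def by blast
  have eq: "(\<lambda>x. v x * w x) = (\<lambda>x. \<Prod>j\<in>J. x j ^ (m j + m' j))"
    by (simp add: m m' power_add prod.distrib)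
  show ?thesis
    unfolding eq using m(2) m'(2) by (intro monomialsI add_mono) auto
qed

lemma lin_comb_monomials_mult:
  assumes J: "finite J" and f: "f \<in> lin_comb (monomials J D)" and g: "g \<in> lin_comb (monomials J D')"
  shows "(\<lambda>x. f x * g x) \<in> lin_comb (monomials J (D + D'))"
proof -
  from f g obtain A B where fg: "f = (\<lambda>x. \<Sum>v\<in>monomials J D. A v * v x)"
    "g = (\<lambda>x. \<Sum>w\<in>monomials J D'. B w * w x)" by (auto simp: lin_comb_def)
  have eq: "(\<lambda>x. f x * g x)
      = (\<lambda>x. \<Sum>v\<in>monomials J D. \<Sum>w\<in>monomials J D'. (A v * B w) * (v x * w x))"
    unfolding fg sum_product by (simp add: mult.assoc mult.left_commute)
  have "(\<lambda>x. v x * w x) \<in> lin_comb (monomials J (D + D'))"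
    if "v \<in> monomials J D" "w \<in> monomials J D'" for v w
    using monomials_mult[OF that] by (rule lin_comb_base[OF finite_monomials[OF J]])
  then show ?thesis unfolding eq by (intro lin_comb_sum lin_comb_scale)
qed

lemma lin_comb_monomials_mono:
  assumes "finite J" "D \<le> D'"
  shows "lin_comb (monomials J D) \<subseteq>
    (lin_comb (monomials J D') :: (('i \<Rightarrow> 'a::comm_ring_1) \<Rightarrow> 'a) set)"
proof
  fix f :: "('i \<Rightarrow> 'a) \<Rightarrow> 'a" assume "f \<in> lin_comb (monomials J D)"
  then obtain A where f: "f = (\<lambda>x. \<Sum>w\<in>monomials J D. A w * w x)" by (auto simp: lin_comb_def)
  have "J \<rightarrow>\<^sub>E {..D} \<subseteq> J \<rightarrow>\<^sub>E {..D'}" using assms(2) by (intro PiE_mono) simp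
  then have sub: "w \<in> monomials J D'" if "w \<in> monomials J D" for w :: "('i \<Rightarrow> 'a) \<Rightarrow> 'a"
    using that unfolding monomials_def by blast
  show "f \<in> lin_comb (monomials J D')"
    unfolding f by (intro lin_comb_sum lin_comb_scale lin_comb_base finite_monomials assms(1) sub)
qed

lemma poly_funs_imp_lin_comb_monomials:
  fixes p :: "('i \<Rightarrow> 'a::comm_ring_1) \<Rightarrow> 'a"
  assumes "finite J" "p \<in> poly_funs J"
  shows "\<exists>D. p \<in> lin_comb (monomials J D)"
  using assms(2)
proof induction
  case (const c)
  have "(\<lambda>x. c * (\<Prod>j\<in>J. x j ^ 0)) \<in> lin_comb (monomials J 0)"
    by (intro lin_comb_scale lin_comb_base finite_monomials assms(1) monomialsI) auto
  then show ?case by auto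
next
  case (coord i)
  have "(\<lambda>x :: 'i \<Rightarrow> 'a. \<Prod>j\<in>J. x j ^ (if j = i then 1 else 0)) \<in> lin_comb (monomials J 1)"
    by (intro lin_comb_base finite_monomials assms(1) monomialsI) auto
  moreover have "(\<lambda>x :: 'i \<Rightarrow> 'a. \<Prod>j\<in>J. x j ^ (if j = i then 1 else 0)) = (\<lambda>x. x i)"
  proof
    fix x :: "'i \<Rightarrow> 'a"
    have "(\<Prod>j\<in>J. x j ^ (if j = i then 1 else 0)) = (\<Prod>j\<in>J. if j = i then x j else 1)"
      by (rule prod.cong) auto
    then show "(\<Prod>j\<in>J. x j ^ (if j = i then 1 else 0)) = x i"
      using coord assms(1) by simp
  qed
  ultimately have "(\<lambda>x :: 'i \<Rightarrow> 'a. x i) \<in> lin_comb (monomials J 1)" by (simp only:)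
  then show ?case by blast
next
  case (add p q)
  then obtain D D' where D: "p \<in> lin_comb (monomials J D)" and D': "q \<in> lin_comb (monomials J D')"
    by blast
  have "p \<in> lin_comb (monomials J (max D D'))"
    by (rule subsetD[OF lin_comb_monomials_mono[OF assms(1) max.cobounded1] D])
  moreover have "q \<in> lin_comb (monomials J (max D D'))"
    by (rule subsetD[OF lin_comb_monomials_mono[OF assms(1) max.cobounded2] D'])
  ultimately show ?case by (intro exI lin_comb_add)
next
  case (mult p q)
  then obtain D D' where "p \<in> lin_comb (monomials J D)" "q \<in> lin_comb (monomials J D')" by blast
  from lin_comb_monomials_mult[OF assms(1) this] show ?case by (rule exI)
qed

lemma lin_comb_monomials_power:
  assumes "finite J" "f \<in> lin_comb (monomials J D)"
  shows "(\<lambda>x. f x ^ m) \<in> lin_comb (monomials J (m * D))"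
proof (induct m)
  case 0
  have "(\<lambda>x. \<Prod>j\<in>J. x j ^ 0) \<in> lin_comb (monomials J 0)"
    by (intro lin_comb_base finite_monomials assms(1) monomialsI) auto
  then show ?case by simp
next
  case (Suc m)
  then show ?case using lin_comb_monomials_mult[OF assms Suc] by simp
qed

lemma lin_comb_monomials_prod:
  fixes s :: nat
  assumes "finite J" "\<And>i. i < s \<Longrightarrow> f i \<in> lin_comb (monomials J D)"
  shows "(\<lambda>x. \<Prod>i<s. f i x ^ m i) \<in> lin_comb (monomials J (\<Sum>i<s. m i * D))"
  using assms(2)
proof (induction s)
  case 0
  have "(\<lambda>x. \<Prod>j\<in>J. x j ^ 0) \<in> lin_comb (monomials J 0)"
    by (intro lin_comb_base finite_monomials assms(1) monomialsI) auto
  then show ?case by simp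
next
  case (Suc s)
  have "(\<lambda>x. \<Prod>i<s. f i x ^ m i) \<in> lin_comb (monomials J (\<Sum>i<s. m i * D))"
    using Suc by simp
  moreover have "(\<lambda>x. f s x ^ m s) \<in> lin_comb (monomials J (m s * D))"
    using Suc.prems[of s] by (intro lin_comb_monomials_power assms(1)) simp
  ultimately show ?case using lin_comb_monomials_mult[OF assms(1)] by simp
qed

lemma finite_common_bound:
  assumes "\<And>i. i < (s::nat) \<Longrightarrow> \<exists>D::nat. P i D" "\<And>i D D'. P i D \<Longrightarrow> D \<le> D' \<Longrightarrow> P i D'"
  shows "\<exists>D. \<forall>i<s. P i D"
proof -
  from assms(1) obtain D where D: "\<And>i. i < s \<Longrightarrow> P i (D i)" by metis
  have "P i (\<Sum>i<s. D i)" if "i < s" for i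
    using that by (intro assms(2)[OF D]) (auto intro: member_le_sum)
  then show ?thesis by blast
qed

text \<open>More polynomial functions than variables satisfy a polynomial relation. Let \<open>D\<close> bound the exponents
in all \<open>f i\<close>. The \<open>N ^ s\<close> power products of the \<open>f i\<close> with exponents below \<open>N\<close> lie in the span of
at most \<open>(s * N * D + 1) ^ card J\<close> monomials. As \<open>s\<close> exceeds \<open>card J\<close>, the first number wins for
large \<open>N\<close>, so that these products are linearly dependent.\<close>
lemma poly_funs_algebraically_dependent:
  fixes f :: "nat \<Rightarrow> ('j \<Rightarrow> 'a::field) \<Rightarrow> 'a"
  assumes J: "finite J" "card J < s" and f: "\<And>i. i < s \<Longrightarrow> f i \<in> poly_funs J"
  shows "\<exists>M q. finite M \<and> M \<noteq> {} \<and> M \<subseteq> {..<s} \<rightarrow>\<^sub>E UNIV \<and> (\<forall>m\<in>M. q m \<noteq> 0)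
    \<and> (\<forall>x. (\<Sum>m\<in>M. q m * (\<Prod>i<s. f i x ^ m i)) = 0)"
proof -
  have "\<exists>D. \<forall>i<s. f i \<in> lin_comb (monomials J D)"
  proof (rule finite_common_bound)
    show "\<exists>D. f i \<in> lin_comb (monomials J D)" if "i < s" for i
      by (rule poly_funs_imp_lin_comb_monomials[OF J(1) f[OF that]])
    show "f i \<in> lin_comb (monomials J D')"
      if "f i \<in> lin_comb (monomials J D)" "D \<le> D'" for i D D'
      by (rule subsetD[OF lin_comb_monomials_mono[OF J(1) that(2)] that(1)])
  qed
  then obtain D where D: "\<And>i. i < s \<Longrightarrow> f i \<in> lin_comb (monomials J D)" by blast
  \<comment> \<open>With this choice \<open>N * N ^ card J\<close> exceeds \<open>(N * (s * D + 1)) ^ card J\<close>.\<close>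
  define N where "N = (s * D + 1) ^ card J + 1"
  define E where "E = {..<s} \<rightarrow>\<^sub>E {..<N}"
  define T :: "(('j \<Rightarrow> 'a) \<Rightarrow> 'a) set" where "T = monomials J (s * (N * D))"
  have E: "finite E" "card E = N ^ s" by (simp_all add: E_def finite_PiE card_PiE)
  have "card T \<le> (s * (N * D) + 1) ^ card J" unfolding T_def by (rule card_monomials_le[OF J(1)])
  also have "\<dots> \<le> (N * (s * D + 1)) ^ card J"
    by (rule power_mono) (auto simp: N_def algebra_simps)
  also have "\<dots> = N ^ card J * (s * D + 1) ^ card J" by (simp only: power_mult_distrib)
  also have "\<dots> < N ^ card J * N"
    by (rule mult_strict_left_mono) (auto simp: N_def)
  also have "\<dots> = N ^ Suc (card J)" by simp
  also have "\<dots> \<le> N ^ s" by (rule power_increasing) (use J(2) in \<open>auto simp: N_def\<close>)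
  finally have card: "card T < card E" using E by simp
  have "\<forall>m\<in>E. \<exists>A. (\<lambda>x. \<Prod>i<s. f i x ^ m i) = (\<lambda>x. \<Sum>w\<in>T. A w * w x)"
  proof
    fix m assume m: "m \<in> E"
    have "(\<Sum>i<s. m i * D) \<le> (\<Sum>i<s. N * D)"
    proof (rule sum_mono)
      fix i assume "i \<in> {..<s}"
      then have "m i < N" using m unfolding E_def by auto
      then show "m i * D \<le> N * D" by simp
    qed
    then have "(\<Sum>i<s. m i * D) \<le> s * (N * D)" by simp
    then have "(\<lambda>x. \<Prod>i<s. f i x ^ m i) \<in> lin_comb T"
      unfolding T_def
      by (rule subsetD[OF lin_comb_monomials_mono[OF J(1)] lin_comb_monomials_prod[OF J(1) D]])
    then show "\<exists>A. (\<lambda>x. \<Prod>i<s. f i x ^ m i) = (\<lambda>x. \<Sum>w\<in>T. A w * w x)"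
      by (simp add: lin_comb_def)
  qed
  from bchoice[OF this] obtain A
    where A: "\<And>m. m \<in> E \<Longrightarrow> (\<lambda>x. \<Prod>i<s. f i x ^ m i) = (\<lambda>x. \<Sum>w\<in>T. A m w * w x)"
    by blast
  have "finite T" by (simp add: T_def finite_monomials J)
  from underdetermined_system_has_solution[OF this E(1) card, of A]
  obtain q where q: "\<exists>m\<in>E. q m \<noteq> 0" "\<And>w. w \<in> T \<Longrightarrow> (\<Sum>m\<in>E. q m * A m w) = 0" by blast
  define M where "M = {m \<in> E. q m \<noteq> 0}"
  have "(\<Sum>m\<in>M. q m * (\<Prod>i<s. f i x ^ m i)) = 0" for x
  proof -
    have "(\<Sum>m\<in>M. q m * (\<Prod>i<s. f i x ^ m i)) = (\<Sum>m\<in>E. q m * (\<Prod>i<s. f i x ^ m i))"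
      unfolding M_def using E(1) by (intro sum.mono_neutral_left) auto
    also have "\<dots> = (\<Sum>m\<in>E. \<Sum>w\<in>T. q m * A m w * w x)"
    proof (rule sum.cong)
      fix m assume "m \<in> E"
      then have "(\<Prod>i<s. f i x ^ m i) = (\<Sum>w\<in>T. A m w * w x)" by (rule A[THEN fun_cong])
      then show "q m * (\<Prod>i<s. f i x ^ m i) = (\<Sum>w\<in>T. q m * A m w * w x)"
        by (simp only: sum_distrib_left mult.assoc)
    qed simp
    also have "\<dots> = (\<Sum>w\<in>T. \<Sum>m\<in>E. q m * A m w * w x)" by (rule sum.swap)
    also have "\<dots> = (\<Sum>w\<in>T. (\<Sum>m\<in>E. q m * A m w) * w x)" by (simp add: sum_distrib_right)
    also have "\<dots> = 0" by (simp add: q(2))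
    finally show ?thesis .
  qed
  moreover have "finite M" "M \<noteq> {}" "M \<subseteq> {..<s} \<rightarrow>\<^sub>E UNIV"
    using E(1) q(1) by (auto simp: M_def E_def)
  ultimately show ?thesis unfolding M_def by blast
qed

lemma poly_funs_sum:
  "(\<And>s. s \<in> S \<Longrightarrow> f s \<in> poly_funs I) \<Longrightarrow> (\<lambda>x. \<Sum>s\<in>S. f s x) \<in> poly_funs I"
  by (induction S rule: infinite_finite_induct) (auto intro: poly_funs.intros)

lemma poly_funs_prod:
  "(\<And>s. s \<in> S \<Longrightarrow> f s \<in> poly_funs I) \<Longrightarrow> (\<lambda>x. \<Prod>s\<in>S. f s x) \<in> poly_funs I"
  by (induction S rule: infinite_finite_induct) (auto intro: poly_funs.intros)

lemma poly_funs_power: "f \<in> poly_funs I \<Longrightarrow> (\<lambda>x. f x ^ m) \<in> poly_funs I"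
  by (induction m) (auto intro: poly_funs.intros)

lemma poly_funs_compose:
  assumes "p \<in> poly_funs I" "\<And>i. i \<in> I \<Longrightarrow> (\<lambda>y. \<phi> y i) \<in> poly_funs J"
  shows "(\<lambda>y. p (\<phi> y)) \<in> poly_funs J"
  using assms by induction (auto intro: poly_funs.intros)

section \<open>Chains of irreducible closed sets\<close>

lemma irreducible_in_zariski_prime:
  fixes Z :: "('i \<Rightarrow> 'a::idom) set"
  assumes Z: "irreducible_in (zariski I) Z" and pq: "p \<in> poly_funs I" "q \<in> poly_funs I"
    and zero: "\<And>x. x \<in> Z \<Longrightarrow> p x * q x = 0"
  shows "(\<forall>x\<in>Z. p x = 0) \<or> (\<forall>x\<in>Z. q x = 0)"
proof -
  have "closedin (zariski I) (zero_locus I {p})" "closedin (zariski I) (zero_locus I {q})"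
    using pq by (auto simp: closedin_zariski)
  moreover have "Z \<subseteq> zero_locus I {p} \<union> zero_locus I {q}"
    using zero Z by (auto simp: zero_locus_def irreducible_in_def topspace_zariski)
  ultimately have "Z \<subseteq> zero_locus I {p} \<or> Z \<subseteq> zero_locus I {q}"
    using Z unfolding irreducible_in_def by blast
  then show ?thesis by (auto simp: zero_locus_def)
qed

text \<open>If \<open>f i\<close> vanishes on \<open>Z i\<close> but not on \<open>Z (i + 1)\<close>, then no polynomial relation between
\<open>f 0, \<dots>, f (s - 1)\<close> holds on \<open>Z s\<close>. The set \<open>M\<close> of exponents and the coefficients \<open>q\<close> describe
the relation. Let \<open>\<mu>\<close> be the least exponent of the last function. Primality on the irreducible top
set allows the division of the relation by the power \<open>\<mu>\<close> of that function; restricting the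
quotient to the next smaller set kills all terms that still contain this function and
leaves a relation between the remaining functions. At the bottom a nonzero constant would
vanish on a nonempty set.\<close>
lemma chain_functions_algebraically_independent:
  fixes Z :: "nat \<Rightarrow> ('i \<Rightarrow> 'a::idom) set" and f :: "nat \<Rightarrow> ('i \<Rightarrow> 'a) \<Rightarrow> 'a"
  assumes irr: "\<And>i. i \<le> s \<Longrightarrow> irreducible_in (zariski I) (Z i)"
    and sub: "\<And>i. i < s \<Longrightarrow> Z i \<subseteq> Z (Suc i)"
    and f: "\<And>i. i < s \<Longrightarrow> f i \<in> poly_funs I"
    and van: "\<And>i x. i < s \<Longrightarrow> x \<in> Z i \<Longrightarrow> f i x = 0"
    and nonvan: "\<And>i. i < s \<Longrightarrow> \<exists>x\<in>Z (Suc i). f i x \<noteq> 0"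
    and M: "finite M" "M \<noteq> {}" "\<And>m m'. m \<in> M \<Longrightarrow> m' \<in> M \<Longrightarrow> \<forall>i<s. m i = m' i \<Longrightarrow> m = m'"
    and q: "\<And>m. m \<in> M \<Longrightarrow> q m \<noteq> 0"
  shows "\<exists>x\<in>Z s. (\<Sum>m\<in>M. q m * (\<Prod>i<s. f i x ^ m i)) \<noteq> 0"
  using assms
proof (induction s arbitrary: M)
  case 0
  from "0.prems"(7) obtain m where "m \<in> M" by blast
  then have "M = {m}" using "0.prems"(8) by auto
  moreover obtain x where "x \<in> Z 0" using "0.prems"(1)[of 0] by (auto simp: irreducible_in_def)
  ultimately show ?case using "0.prems"(9)[of m] by auto
next
  case (Suc s)
  define \<mu> where "\<mu> = Min ((\<lambda>m. m s) ` M)"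
  define M' where "M' = {m \<in> M. m s = \<mu>}"
  have ge: "\<mu> \<le> m s" if "m \<in> M" for m using that Suc.prems(6) by (simp add: \<mu>_def)
  have "\<mu> \<in> (\<lambda>m. m s) ` M" unfolding \<mu>_def using Suc.prems(6,7) by (intro Min_in) auto
  then have "M' \<noteq> {}" by (auto simp: M'_def)
  moreover have "finite M'" using Suc.prems(6) by (simp add: M'_def)
  moreover have "m = m'" if "m \<in> M'" "m' \<in> M'" "\<forall>i<s. m i = m' i" for m m'
    using that Suc.prems(8)[of m m'] by (auto simp: M'_def less_Suc_eq)
  moreover have "q m \<noteq> 0" if "m \<in> M'" for m using that Suc.prems(9) by (auto simp: M'_def)
  ultimately have "\<exists>x\<in>Z s. (\<Sum>m\<in>M'. q m * (\<Prod>i<s. f i x ^ m i)) \<noteq> 0"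
    using Suc.prems(1-5) by (intro Suc.IH) auto
  then obtain x where x: "x \<in> Z s" "(\<Sum>m\<in>M'. q m * (\<Prod>i<s. f i x ^ m i)) \<noteq> 0" by blast
  define G where "G y = (\<Sum>m\<in>M. q m * ((\<Prod>i<s. f i y ^ m i) * f s y ^ (m s - \<mu>)))" for y
  have G: "G \<in> poly_funs I"
    unfolding G_def using Suc.prems(3)
    by (intro poly_funs_sum poly_funs.mult poly_funs.const poly_funs_prod poly_funs_power) auto
  have "G x = (\<Sum>m\<in>M'. q m * ((\<Prod>i<s. f i x ^ m i) * f s x ^ (m s - \<mu>)))"
    unfolding G_def
  proof (rule sum.mono_neutral_right)
    show "\<forall>m\<in>M - M'. q m * ((\<Prod>i<s. f i x ^ m i) * f s x ^ (m s - \<mu>)) = 0"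
    proof
      fix m assume "m \<in> M - M'"
      then have "m s - \<mu> > 0" using ge[of m] by (auto simp: M'_def)
      moreover have "f s x = 0" using Suc.prems(4) x(1) by simp
      ultimately show "q m * ((\<Prod>i<s. f i x ^ m i) * f s x ^ (m s - \<mu>)) = 0" by simp
    qed
  qed (use Suc.prems(6) in \<open>auto simp: M'_def\<close>)
  also have "\<dots> = (\<Sum>m\<in>M'. q m * (\<Prod>i<s. f i x ^ m i))" by (rule sum.cong) (auto simp: M'_def)
  finally have "G x \<noteq> 0" using x(2) by simp
  moreover have "x \<in> Z (Suc s)" using x(1) Suc.prems(2)[of s] by auto
  ultimately have G_nz: "\<not> (\<forall>y\<in>Z (Suc s). G y = 0)" by blast
  have f_nz: "\<not> (\<forall>y\<in>Z (Suc s). f s y ^ \<mu> = 0)" using Suc.prems(5)[of s] by auto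
  have "\<not> (\<forall>y\<in>Z (Suc s). f s y ^ \<mu> * G y = 0)"
    using irreducible_in_zariski_prime[OF Suc.prems(1)[of "Suc s"] poly_funs_power G, of "f s" \<mu>]
      Suc.prems(3)[of s] G_nz f_nz by blast
  then obtain y where y: "y \<in> Z (Suc s)" "f s y ^ \<mu> * G y \<noteq> 0" by blast
  have "f s y ^ \<mu> * G y = (\<Sum>m\<in>M. q m * (\<Prod>i<Suc s. f i y ^ m i))"
    unfolding G_def sum_distrib_left
  proof (rule sum.cong)
    fix m assume "m \<in> M"
    then have "f s y ^ m s = f s y ^ \<mu> * f s y ^ (m s - \<mu>)" using ge by (simp flip: power_add)
    then show "f s y ^ \<mu> * (q m * ((\<Prod>i<s. f i y ^ m i) * f s y ^ (m s - \<mu>)))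
        = q m * (\<Prod>i<Suc s. f i y ^ m i)" by (simp add: ac_simps)
  qed simp
  then show ?case using y by auto
qed

text \<open>This is the upper bound for dimensions. A chain of length \<open>d\<close> yields \<open>d\<close> functions
without a polynomial relation on its largest member, whereas pulling them back along the
parametrization \<open>\<phi>\<close> gives polynomial functions in \<open>card J\<close> variables, which are dependent as soon as
\<open>d\<close> exceeds \<open>card J\<close>.\<close>
lemma irreducible_chain_in_image_bounded:
  fixes Z :: "nat \<Rightarrow> ('i \<Rightarrow> 'a::field) set" and \<phi> :: "('j \<Rightarrow> 'a) \<Rightarrow> 'i \<Rightarrow> 'a"
  assumes J: "finite J"
    and \<phi>: "\<And>i. i \<in> I \<Longrightarrow> (\<lambda>y. \<phi> y i) \<in> poly_funs J"
    and image: "Z d \<subseteq> range \<phi>"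
    and Z: "\<And>i. i \<le> d \<Longrightarrow> closedin (zariski I) (Z i) \<and> irreducible_in (zariski I) (Z i)"
    and strict: "\<And>i. i < d \<Longrightarrow> Z i \<subset> Z (Suc i)"
  shows "d \<le> card J"
proof (rule ccontr)
  assume "\<not> d \<le> card J"
  then have less: "card J < d" by simp
  have "\<exists>f. f \<in> poly_funs I \<and> (\<forall>x\<in>Z i. f x = 0) \<and> (\<exists>x\<in>Z (Suc i). f x \<noteq> 0)"
    if i: "i < d" for i
  proof -
    obtain P where P: "P \<subseteq> poly_funs I" "Z i = zero_locus I P"
      using Z[of i] i closedin_zariski[of I "Z i"] by (meson less_imp_le)
    obtain x where x: "x \<in> Z (Suc i)" "x \<notin> Z i" using strict[OF i] by blast
    then have "x \<in> I \<rightarrow>\<^sub>E UNIV"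
      using Z[of "Suc i"] i by (auto simp: irreducible_in_def topspace_zariski)
    with x(2) P obtain p where "p \<in> P" "p x \<noteq> 0" by (auto simp: zero_locus_def)
    then show ?thesis using P x(1) by (intro exI[of _ p]) (auto simp: zero_locus_def)
  qed
  then obtain f where f: "\<And>i. i < d \<Longrightarrow> f i \<in> poly_funs I"
    "\<And>i x. i < d \<Longrightarrow> x \<in> Z i \<Longrightarrow> f i x = 0" "\<And>i. i < d \<Longrightarrow> \<exists>x\<in>Z (Suc i). f i x \<noteq> 0"
    by metis
  have "\<exists>M q. finite M \<and> M \<noteq> {} \<and> M \<subseteq> {..<d} \<rightarrow>\<^sub>E UNIV \<and> (\<forall>m\<in>M. q m \<noteq> 0)
      \<and> (\<forall>y. (\<Sum>m\<in>M. q m * (\<Prod>i<d. f i (\<phi> y) ^ m i)) = 0)"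
  proof (rule poly_funs_algebraically_dependent[OF J less])
    show "(\<lambda>y. f i (\<phi> y)) \<in> poly_funs J" if "i < d" for i
      by (rule poly_funs_compose[OF f(1)[OF that] \<phi>])
  qed
  then obtain M q where M: "finite M" "M \<noteq> {}" "M \<subseteq> {..<d} \<rightarrow>\<^sub>E UNIV" "\<forall>m\<in>M. q m \<noteq> 0"
    and rel: "\<forall>y. (\<Sum>m\<in>M. q m * (\<Prod>i<d. f i (\<phi> y) ^ m i)) = 0"
    by (elim exE conjE) (rule that)
  have sep: "m = m'" if "m \<in> M" "m' \<in> M" "\<forall>i<d. m i = m' i" for m m'
    using that M(3) by (intro PiE_ext[of m "{..<d}" "\<lambda>_. UNIV"]) auto
  have "\<exists>x\<in>Z d. (\<Sum>m\<in>M. q m * (\<Prod>i<d. f i x ^ m i)) \<noteq> 0"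
    using Z strict f M sep by (intro chain_functions_algebraically_independent) auto
  then show False using rel image by auto
qed

section \<open>Linear subspaces and their dimension\<close>

lemma poly_funs_on_line:
  fixes p :: "('i \<Rightarrow> 'a::comm_ring_1) \<Rightarrow> 'a"
  assumes "p \<in> poly_funs I"
  shows "\<exists>P. \<forall>t. p (\<lambda>i\<in>I. x i + t * v i) = poly P t"
  using assms
proof induction
  case (const c)
  show ?case by (intro exI[of _ "[:c:]"]) simp
next
  case (coord i)
  then show ?case by (intro exI[of _ "[:x i, v i:]"]) simp
next
  case (add p q)
  then obtain P Q where "\<forall>t. p (\<lambda>i\<in>I. x i + t * v i) = poly P t"
    "\<forall>t. q (\<lambda>i\<in>I. x i + t * v i) = poly Q t" by blast
  then have "\<forall>t. p (\<lambda>i\<in>I. x i + t * v i) + q (\<lambda>i\<in>I. x i + t * v i) = poly (P + Q) t"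
    by (metis poly_add)
  then show ?case by blast
next
  case (mult p q)
  then obtain P Q where "\<forall>t. p (\<lambda>i\<in>I. x i + t * v i) = poly P t"
    "\<forall>t. q (\<lambda>i\<in>I. x i + t * v i) = poly Q t" by blast
  then have "\<forall>t. p (\<lambda>i\<in>I. x i + t * v i) * q (\<lambda>i\<in>I. x i + t * v i) = poly (P * Q) t"
    by (metis poly_mult)
  then show ?case by blast
qed

text \<open>Two proper closed subsets of \<open>L\<close> would give polynomials \<open>p\<close> and \<open>q\<close> that are nonzero at points
\<open>x\<close> and \<open>y\<close> of \<open>L\<close> but whose product vanishes on \<open>L\<close>. On the line through \<open>x\<close> and \<open>y\<close> they become
nonzero univariate polynomials, whose product cannot vanish at all elements of an infinite field.\<close>
lemma line_closed_imp_irreducible: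
  fixes L :: "('i \<Rightarrow> 'a::field_char_0) set"
  assumes L: "L \<noteq> {}" "L \<subseteq> I \<rightarrow>\<^sub>E UNIV"
    and line: "\<And>x y t. x \<in> L \<Longrightarrow> y \<in> L \<Longrightarrow> (\<lambda>i\<in>I. x i + t * (y i - x i)) \<in> L"
  shows "irreducible_in (zariski I) L"
  unfolding irreducible_in_def
proof (intro conjI allI impI)
  show "L \<subseteq> topspace (zariski I)" using L(2) by (simp add: topspace_zariski)
  fix A B assume AB: "closedin (zariski I) A \<and> closedin (zariski I) B \<and> L \<subseteq> A \<union> B"
  show "L \<subseteq> A \<or> L \<subseteq> B"
  proof (rule ccontr)
    assume "\<not> (L \<subseteq> A \<or> L \<subseteq> B)"
    then obtain x y where xy: "x \<in> L" "x \<notin> A" "y \<in> L" "y \<notin> B" by blast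
    obtain P Q where P: "P \<subseteq> poly_funs I" "A = zero_locus I P"
      and Q: "Q \<subseteq> poly_funs I" "B = zero_locus I Q" using AB by (auto simp: closedin_zariski)
    obtain p where p: "p \<in> P" "p x \<noteq> 0" using xy P(2) L(2) by (auto simp: zero_locus_def)
    obtain q where q: "q \<in> Q" "q y \<noteq> 0" using xy Q(2) L(2) by (auto simp: zero_locus_def)
    define l where "l t = (\<lambda>i\<in>I. x i + t * (y i - x i))" for t
    obtain F where F: "\<And>t. p (l t) = poly F t"
      using poly_funs_on_line[of p I x "\<lambda>i. y i - x i"] p(1) P(1) unfolding l_def by blast
    obtain G where G: "\<And>t. q (l t) = poly G t"
      using poly_funs_on_line[of q I x "\<lambda>i. y i - x i"] q(1) Q(1) unfolding l_def by blast
    have "x \<in> I \<rightarrow>\<^sub>E UNIV" "y \<in> I \<rightarrow>\<^sub>E UNIV" using xy L(2) by blast+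
    then have "l 0 = x" "l 1 = y"
      by (auto simp: l_def intro!: PiE_ext[of _ I "\<lambda>_. UNIV"])
    then have "F \<noteq> 0" "G \<noteq> 0" using F[of 0] G[of 1] p q by auto
    then have "F * G \<noteq> 0" by simp
    moreover have "poly (F * G) t = 0" for t
    proof -
      have "l t \<in> L" using line xy by (simp add: l_def)
      then have "l t \<in> A \<union> B" using AB by blast
      then show ?thesis using P Q p q F[of t] G[of t] by (auto simp: zero_locus_def)
    qed
    ultimately show False using poly_all_0_iff_0 by blast
  qed
qed (use L in auto)

text \<open>The linear subspace in which the coordinates in \<open>J\<close> are free parameters and determine all
coordinates through the matrix \<open>b\<close>. It has dimension \<open>card J\<close> when \<open>b\<close> restricts to the identity
matrix on \<open>J\<close>; without that condition the parameters are subject to linear constraints.\<close>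
definition graph_subspace ::
    "'i set \<Rightarrow> 'i set \<Rightarrow> ('i \<Rightarrow> 'i \<Rightarrow> 'a::comm_ring_1) \<Rightarrow> ('i \<Rightarrow> 'a) set" where
  "graph_subspace I J b = {x \<in> I \<rightarrow>\<^sub>E UNIV. \<forall>i\<in>I. x i = (\<Sum>j\<in>J. b i j * x j)}"

lemma closedin_graph_subspace:
  fixes b :: "'i \<Rightarrow> 'i \<Rightarrow> 'a::idom"
  assumes "J \<subseteq> I"
  shows "closedin (zariski I) (graph_subspace I J b)"
proof -
  let ?P = "(\<lambda>i x. x i + (\<Sum>j\<in>J. - b i j * x j)) ` I"
  have "graph_subspace I J b = zero_locus I ?P"
    by (auto simp: graph_subspace_def zero_locus_def sum_negf)
  moreover have "?P \<subseteq> poly_funs I"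
    using assms by (auto intro!: poly_funs.add poly_funs.coord poly_funs_sum poly_funs.mult
        poly_funs.const simp del: mult_minus_left)
  ultimately show ?thesis unfolding closedin_zariski by blast
qed

lemma irreducible_graph_subspace:
  fixes b :: "'i \<Rightarrow> 'i \<Rightarrow> 'a::field_char_0"
  assumes "J \<subseteq> I"
  shows "irreducible_in (zariski I) (graph_subspace I J b)"
proof (rule line_closed_imp_irreducible)
  have "(\<lambda>i\<in>I. 0) \<in> graph_subspace I J b"
    using assms by (auto simp: graph_subspace_def subset_iff intro!: sum.neutral)
  then show "graph_subspace I J b \<noteq> {}" by blast
  show "graph_subspace I J b \<subseteq> I \<rightarrow>\<^sub>E UNIV" by (auto simp: graph_subspace_def)
  fix x y t assume xy: "x \<in> graph_subspace I J b" "y \<in> graph_subspace I J b"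
  have "x i + t * (y i - x i) = (\<Sum>j\<in>J. b i j * (\<lambda>i\<in>I. x i + t * (y i - x i)) j)" if "i \<in> I" for i
  proof -
    have "(\<Sum>j\<in>J. b i j * (\<lambda>i\<in>I. x i + t * (y i - x i)) j)
        = (\<Sum>j\<in>J. b i j * x j + t * (b i j * y j - b i j * x j))"
      using assms by (intro sum.cong) (auto simp: algebra_simps)
    also have "\<dots> = (\<Sum>j\<in>J. b i j * x j) + t * ((\<Sum>j\<in>J. b i j * y j) - (\<Sum>j\<in>J. b i j * x j))"
      by (simp add: sum.distrib sum_subtractf flip: sum_distrib_left)
    also have "\<dots> = x i + t * (y i - x i)" using xy that by (simp add: graph_subspace_def)
    finally show ?thesis by simp
  qed
  then show "(\<lambda>i\<in>I. x i + t * (y i - x i)) \<in> graph_subspace I J b"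
    by (simp add: graph_subspace_def)
qed

lemma irreducible_in_finite_Union:
  assumes "irreducible_in X Z" "finite K" "\<And>k. k \<in> K \<Longrightarrow> closedin X (C k)" "Z \<subseteq> (\<Union>k\<in>K. C k)"
  shows "\<exists>k\<in>K. Z \<subseteq> C k"
  using assms(2-4)
proof (induction K rule: finite_induct)
  case empty
  then show ?case using assms(1) by (auto simp: irreducible_in_def)
next
  case (insert k K)
  have "closedin X (C k)" "closedin X (\<Union>k\<in>K. C k)"
    using insert.prems(1) insert.hyps(1) by (auto intro!: closedin_Union)
  moreover have "Z \<subseteq> C k \<union> (\<Union>k\<in>K. C k)" using insert.prems(2) by auto
  ultimately have "Z \<subseteq> C k \<or> Z \<subseteq> (\<Union>k\<in>K. C k)"
    using assms(1) unfolding irreducible_in_def by blast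
  then show ?case using insert by auto
qed

text \<open>For a closed subspace, the closed subsets of the subspace are closed in the whole space, so that
irreducibility can be tested in either of them.\<close>
lemma irreducible_in_subtopology_closed:
  assumes "closedin X A" "Z \<subseteq> A"
  shows "irreducible_in (subtopology X A) Z \<longleftrightarrow> irreducible_in X Z"
proof -
  have top: "Z \<subseteq> topspace (subtopology X A) \<longleftrightarrow> Z \<subseteq> topspace X" using assms by auto
  have "(\<forall>B C. closedin (subtopology X A) B \<and> closedin (subtopology X A) C \<and> Z \<subseteq> B \<union> C \<longrightarrow> Z \<subseteq> B \<or> Z \<subseteq> C)
      \<longleftrightarrow> (\<forall>B C. closedin X B \<and> closedin X C \<and> Z \<subseteq> B \<union> C \<longrightarrow> Z \<subseteq> B \<or> Z \<subseteq> C)" (is "?L \<longleftrightarrow> ?R")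
  proof
    assume L: ?L
    show ?R
    proof (intro allI impI)
      fix B C assume BC: "closedin X B \<and> closedin X C \<and> Z \<subseteq> B \<union> C"
      then have "closedin (subtopology X A) (B \<inter> A)" "closedin (subtopology X A) (C \<inter> A)"
        by (auto simp: closedin_subtopology)
      moreover have "Z \<subseteq> (B \<inter> A) \<union> (C \<inter> A)" using BC assms(2) by blast
      ultimately have "Z \<subseteq> B \<inter> A \<or> Z \<subseteq> C \<inter> A" using L by blast
      then show "Z \<subseteq> B \<or> Z \<subseteq> C" by blast
    qed
  next
    assume R: ?R
    have "closedin X B" if "closedin (subtopology X A) B" for B
      using that assms(1) by (rule closedin_trans_full)
    with R show ?L by blast
  qed
  then show ?thesis unfolding irreducible_in_def top by blast
qed

text \<open>The largest set of an irreducible chain lies in one of the finitely many closed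
subspaces, and that subspace is parametrized by the affine space over its set of parameters;
this bounds the length of the chain. Conversely, setting the parameters of a largest subspace to
zero one after the other gives a chain of \<open>d + 1\<close> linear subspaces.\<close>
lemma krull_dim_finite_Union_graph_subspaces:
  fixes b :: "'k \<Rightarrow> 'i \<Rightarrow> 'i \<Rightarrow> 'a::field_char_0"
  assumes I: "finite I" and K: "finite K" and J: "\<And>k. k \<in> K \<Longrightarrow> J k \<subseteq> I"
    and b: "\<And>k i j. k \<in> K \<Longrightarrow> i \<in> J k \<Longrightarrow> j \<in> J k \<Longrightarrow> b k i j = (if i = j then 1 else 0)"
    and le: "\<And>k. k \<in> K \<Longrightarrow> card (J k) \<le> d" and k0: "k0 \<in> K" "card (J k0) = d"
  shows "krull_dim (subtopology (zariski I) (\<Union>k\<in>K. graph_subspace I (J k) (b k))) = enat d"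
proof (rule antisym)
  let ?G = "\<lambda>k. graph_subspace I (J k) (b k)"
  let ?A = "\<Union>k\<in>K. ?G k"
  let ?X = "subtopology (zariski I) ?A"
  have closedA: "closedin (zariski I) ?A"
    using K by (intro closedin_Union) (auto intro: closedin_graph_subspace[OF J])
  have transfer: "closedin ?X Z \<and> irreducible_in ?X Z
      \<longleftrightarrow> closedin (zariski I) Z \<and> irreducible_in (zariski I) Z" if "Z \<subseteq> ?A" for Z
    using irreducible_in_subtopology_closed[OF closedA that] closedin_trans_full[OF _ closedA]
      closedin_subset_topspace[OF _ that] by blast
  show "krull_dim ?X \<le> enat d"
    unfolding krull_dim_def
  proof (rule Sup_least, clarify)
    fix l Z assume Z: "\<forall>i\<le>l. closedin ?X (Z i) \<and> irreducible_in ?X (Z i)"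
      and strict: "\<forall>i<l. Z i \<subset> Z (Suc i)"
    have sub: "Z i \<subseteq> ?A" if "i \<le> l" for i
      using Z that closedin_subset[of ?X "Z i"] topspace_subtopology_subset by fastforce
    then have Z': "closedin (zariski I) (Z i) \<and> irreducible_in (zariski I) (Z i)" if "i \<le> l" for i
      using Z transfer[OF sub[OF that]] that by blast
    have "\<exists>k\<in>K. Z l \<subseteq> ?G k"
    proof (rule irreducible_in_finite_Union)
      show "irreducible_in (zariski I) (Z l)" "Z l \<subseteq> ?A" using Z'[of l] sub[of l] by auto
    qed (simp_all add: K J closedin_graph_subspace)
    then obtain k where k: "k \<in> K" "Z l \<subseteq> ?G k" by blast
    define \<phi> where "\<phi> y = (\<lambda>i\<in>I. \<Sum>j\<in>J k. b k i j * y j)" for y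
    have "l \<le> card (J k)"
    proof (rule irreducible_chain_in_image_bounded[where \<phi> = \<phi> and Z = Z and I = I])
      show "finite (J k)" using J[OF k(1)] I by (rule finite_subset)
      show "(\<lambda>y. \<phi> y i) \<in> poly_funs (J k)" if "i \<in> I" for i
        using that by (auto simp: \<phi>_def intro!: poly_funs_sum poly_funs.mult poly_funs.const
            poly_funs.coord)
      have "x = \<phi> x" if "x \<in> ?G k" for x
        using that by (intro PiE_ext[of x I "\<lambda>_. UNIV"]) (auto simp: graph_subspace_def \<phi>_def)
      then show "Z l \<subseteq> range \<phi>" using k(2) by blast
      show "closedin (zariski I) (Z i) \<and> irreducible_in (zariski I) (Z i)" if "i \<le> l" for i
        using Z' that .
      show "Z i \<subset> Z (Suc i)" if "i < l" for i using strict that by blast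
    qed
    then show "enat l \<le> enat d" using le[OF k(1)] by simp
  qed
  show "enat d \<le> krull_dim ?X"
  proof -
    obtain h where h: "bij_betw h {..<d} (J k0)"
      using ex_bij_betw_nat_finite[of "J k0"] finite_subset[OF J[OF k0(1)] I] k0(2)
      by (auto simp: atLeast0LessThan)
    let ?Z = "\<lambda>i. graph_subspace I (h ` {..<i}) (b k0)"
    have hJ: "h ` {..<i} \<subseteq> J k0" if "i \<le> d" for i
      using h that by (auto simp: bij_betw_def)
    \<comment> \<open>Dropping a parameter forces the corresponding coordinate to vanish.\<close>
    have mono: "graph_subspace I J1 (b k0) \<subseteq> graph_subspace I J2 (b k0)"
      if "J1 \<subseteq> J2" "J2 \<subseteq> J k0" for J1 J2
    proof
      fix x assume x: "x \<in> graph_subspace I J1 (b k0)"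
      have "x j = 0" if "j \<in> J2 - J1" for j
      proof -
        have "x j = (\<Sum>i\<in>J1. b k0 j i * x i)"
          using x that \<open>J2 \<subseteq> J k0\<close> J[OF k0(1)] by (auto simp: graph_subspace_def)
        also have "\<dots> = 0"
        proof (rule sum.neutral, intro ballI)
          fix i assume "i \<in> J1"
          then have "i \<in> J k0" "j \<in> J k0" "j \<noteq> i"
            using that \<open>J1 \<subseteq> J2\<close> \<open>J2 \<subseteq> J k0\<close> by blast+
          then have "b k0 j i = 0" using b[OF k0(1)] by simp
          then show "b k0 j i * x i = 0" by simp
        qed
        finally show ?thesis .
      qed
      moreover have "finite J2" using that(2) J[OF k0(1)] I by (meson finite_subset)
      ultimately have "(\<Sum>j\<in>J2. b k0 i j * x j) = (\<Sum>j\<in>J1. b k0 i j * x j)" for i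
        using \<open>J1 \<subseteq> J2\<close> by (intro sum.mono_neutral_right) auto
      then show "x \<in> graph_subspace I J2 (b k0)" using x by (simp add: graph_subspace_def)
    qed
    have "\<forall>i\<le>d. closedin ?X (?Z i) \<and> irreducible_in ?X (?Z i)"
    proof (intro allI impI)
      fix i assume "i \<le> d"
      have "?Z i \<subseteq> ?G k0" by (rule mono[OF hJ[OF \<open>i \<le> d\<close>] order_refl])
      then have sub: "?Z i \<subseteq> ?A" using k0(1) by blast
      have "h ` {..<i} \<subseteq> I" using hJ[OF \<open>i \<le> d\<close>] J[OF k0(1)] by (rule order_trans)
      then show "closedin ?X (?Z i) \<and> irreducible_in ?X (?Z i)"
        unfolding transfer[OF sub] by (intro conjI closedin_graph_subspace irreducible_graph_subspace)
    qed
    moreover have "\<forall>i<d. ?Z i \<subset> ?Z (Suc i)"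
    proof (intro allI impI psubsetI)
      fix i assume i: "i < d"
      show "?Z i \<subseteq> ?Z (Suc i)" using i hJ[of "Suc i"] by (intro mono) auto
      have hi: "h i \<in> J k0" "h i \<notin> h ` {..<i}"
        using h i inj_on_image_mem_iff[of h "{..<d}" i "{..<i}"] by (auto simp: bij_betw_def)
      have hiI: "h i \<in> I" "h ` {..<i} \<subseteq> I" using hi hJ[of i] i J[OF k0(1)] by auto
      \<comment> \<open>The column of \<open>b k0\<close> belonging to the new parameter lies in the larger subspace only.\<close>
      define x where "x = (\<lambda>p\<in>I. b k0 p (h i))"
      have x_i: "x (h i) = 1" using hi hiI b[OF k0(1)] by (simp add: x_def)
      have x_less: "x j = 0" if "j \<in> h ` {..<i}" for j
      proof -
        have "j \<noteq> h i" using that hi(2) by metis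
        moreover have "j \<in> J k0" "j \<in> I" using that hiI(2) hJ[of i] i by auto
        ultimately show ?thesis using hi b[OF k0(1)] by (simp add: x_def)
      qed
      have "(\<Sum>j\<in>h ` {..<Suc i}. b k0 p j * x j) = b k0 p (h i)" for p
      proof -
        have "(\<Sum>j\<in>h ` {..<Suc i}. b k0 p j * x j)
            = b k0 p (h i) * x (h i) + (\<Sum>j\<in>h ` {..<i}. b k0 p j * x j)"
          using hi(2) by (simp add: lessThan_Suc)
        then show ?thesis using x_i x_less by (simp add: sum.neutral)
      qed
      then have "x \<in> ?Z (Suc i)" by (simp add: graph_subspace_def x_def)
      moreover have "x \<notin> ?Z i"
      proof
        assume "x \<in> ?Z i"
        then have "x (h i) = (\<Sum>j\<in>h ` {..<i}. b k0 (h i) j * x j)"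
          using hiI by (simp add: graph_subspace_def)
        also have "\<dots> = 0" using x_less by (simp add: sum.neutral)
        finally show False using x_i by simp
      qed
      ultimately show "?Z i \<noteq> ?Z (Suc i)" by blast
    qed
    ultimately show ?thesis
      unfolding krull_dim_def by (intro Sup_upper CollectI exI conjI) (rule refl)
  qed
qed

section \<open>Coordinates in an evolution algebra\<close>

context evolution_algebra
begin

definition coord :: "nat \<Rightarrow> 'v \<Rightarrow> 'a" where
  "coord i x = representation (e ` {1..n}) x (e i)"

lemma coord_add: "coord i (x + y) = coord i x + coord i y"
  unfolding coord_def by (subst representation_add[OF basis_independent]) (simp_all only: basis_span UNIV_I)

lemma coord_scale: "coord i (c *s x) = c * coord i x"
  unfolding coord_def by (subst representation_scale[OF basis_independent]) (simp_all only: basis_span UNIV_I)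

lemma coord_zero: "coord i 0 = 0"
  unfolding coord_def by (simp add: representation_zero)

lemma coord_sum: "coord i (\<Sum>s\<in>S. f s) = (\<Sum>s\<in>S. coord i (f s))"
  by (induction S rule: infinite_finite_induct) (simp_all add: coord_zero coord_add)

lemma coord_basis:
  "i \<in> {1..n} \<Longrightarrow> j \<in> {1..n} \<Longrightarrow> coord i (e j) = (if i = j then 1 else 0)"
  unfolding coord_def using basis_inj
  by (subst representation_basis[OF basis_independent]) (auto simp: inj_on_eq_iff)

lemma coord_expansion: "(\<Sum>i = 1..n. coord i x *s e i) = x"
proof -
  have "(\<Sum>b\<in>e ` {1..n}. representation (e ` {1..n}) x b *s b) = x"
    by (rule sum_representation_eq[OF basis_independent])
      (simp_all only: basis_span UNIV_I finite_imageI finite_atLeastAtMost order_refl)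
  then show ?thesis unfolding sum.reindex[OF basis_inj] coord_def comp_def .
qed

lemma coord_eqI:
  assumes "\<And>i. 1 \<le> i \<Longrightarrow> i \<le> n \<Longrightarrow> coord i x = coord i y"
  shows "x = y"
proof -
  have "(\<Sum>i = 1..n. coord i x *s e i) = (\<Sum>i = 1..n. coord i y *s e i)"
    using assms by (intro sum.cong) auto
  then show ?thesis by (simp only: coord_expansion)
qed

text \<open>Applied to left and right multiplications, this also expands products.\<close>
lemma linear_expansion:
  assumes "Vector_Spaces.linear scale scale T"
  shows "T x = (\<Sum>j = 1..n. coord j x *s T (e j))"
proof -
  interpret T: Vector_Spaces.linear scale scale T by fact
  have "T (\<Sum>j = 1..n. coord j x *s e j) = (\<Sum>j = 1..n. coord j x *s T (e j))"
    by (simp add: T.sum T.scale)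
  then show ?thesis by (simp only: coord_expansion)
qed

lemma coord_linear:
  assumes "Vector_Spaces.linear scale scale T"
  shows "coord i (T x) = (\<Sum>j = 1..n. coord j x * coord i (T (e j)))"
  by (subst linear_expansion[OF assms]) (simp add: coord_sum coord_scale)

lemma mul_basis_right: "i \<in> {1..n} \<Longrightarrow> x \<bullet> e i = coord i x *s (e i \<bullet> e i)"
proof -
  assume i: "i \<in> {1..n}"
  have "x \<bullet> e i = (\<Sum>j = 1..n. coord j x *s (e j \<bullet> e i))"
    by (rule linear_expansion[OF linear_mul_left])
  also have "\<dots> = (\<Sum>j = 1..n. if j = i then coord i x *s (e i \<bullet> e i) else 0)"
    using i natural_basis[of _ i] by (intro sum.cong) auto
  finally show ?thesis using i by simp
qed

lemma mul_basis_left: "i \<in> {1..n} \<Longrightarrow> e i \<bullet> x = coord i x *s (e i \<bullet> e i)"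
proof -
  assume i: "i \<in> {1..n}"
  have "e i \<bullet> x = (\<Sum>j = 1..n. coord j x *s (e i \<bullet> e j))"
    by (rule linear_expansion[OF linear_mul_right])
  also have "\<dots> = (\<Sum>j = 1..n. if j = i then coord i x *s (e i \<bullet> e i) else 0)"
    using i natural_basis[of i] by (intro sum.cong) auto
  finally show ?thesis using i by simp
qed

lemma mul_expansion: "x \<bullet> y = (\<Sum>l = 1..n. (coord l x * coord l y) *s (e l \<bullet> e l))"
proof -
  have "x \<bullet> y = (\<Sum>l = 1..n. coord l x *s (e l \<bullet> y))"
    by (rule linear_expansion[OF linear_mul_left])
  also have "\<dots> = (\<Sum>l = 1..n. (coord l x * coord l y) *s (e l \<bullet> e l))"
    by (intro sum.cong) (simp_all add: mul_basis_left[of _ y])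
  finally show ?thesis .
qed

text \<open>The endomorphism with matrix \<open>A\<close>: the column \<open>j\<close> of \<open>A\<close> is the image of \<open>e j\<close>.\<close>
definition endo :: "(nat \<Rightarrow> nat \<Rightarrow> 'a) \<Rightarrow> 'v \<Rightarrow> 'v" where
  "endo A x = (\<Sum>j = 1..n. coord j x *s (\<Sum>i = 1..n. A i j *s e i))"

lemma linear_endo: "Vector_Spaces.linear scale scale (endo A)"
proof -
  have "module_hom scale scale (endo A)"
  proof (unfold_locales, goal_cases)
    case (1 x y)
    show ?case by (simp add: endo_def coord_add scale_left_distrib sum.distrib)
  next
    case (2 c x)
    show ?case by (simp add: endo_def coord_scale scale_sum_right mult.assoc)
  qed
  then show ?thesis by (simp add: module_hom_iff_linear)
qed

lemma coord_endo:
  assumes "i \<in> {1..n}"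
  shows "coord i (endo A x) = (\<Sum>j = 1..n. coord j x * A i j)"
proof -
  have "coord i (\<Sum>p = 1..n. A p j *s e p) = (\<Sum>p = 1..n. if p = i then A i j else 0)" for j
    unfolding coord_sum coord_scale using assms by (intro sum.cong) (auto simp: coord_basis)
  then show ?thesis using assms by (simp add: endo_def coord_sum coord_scale)
qed

lemma coord_endo_basis:
  assumes "i \<in> {1..n}" "j \<in> {1..n}"
  shows "coord i (endo A (e j)) = A i j"
proof -
  have "coord i (endo A (e j)) = (\<Sum>p = 1..n. if p = j then A i j else 0)"
    unfolding coord_endo[OF assms(1)] using assms(2) by (intro sum.cong) (auto simp: coord_basis)
  then show ?thesis using assms(2) by simp
qed

lemma matrix_entries_eq:
  "i \<in> {1..n} \<Longrightarrow> j \<in> {1..n} \<Longrightarrow> matrix_entries scale n e T (i, j) = coord i (T (e j))"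
  by (simp add: matrix_entries_def coord_def)

lemma matrix_entries_extensional: "matrix_entries scale n e T \<in> {1..n} \<times> {1..n} \<rightarrow>\<^sub>E UNIV"
  by (auto simp: matrix_entries_def)

lemma matrix_entries_endo:
  assumes "x \<in> {1..n} \<times> {1..n} \<rightarrow>\<^sub>E UNIV"
  shows "matrix_entries scale n e (endo (\<lambda>i j. x (i, j))) = x"
proof (rule PiE_ext[OF matrix_entries_extensional assms])
  fix p assume "p \<in> {1..n} \<times> {1..n}"
  then show "matrix_entries scale n e (endo (\<lambda>i j. x (i, j))) p = x p"
    by (auto simp: matrix_entries_eq coord_endo_basis simp del: atLeastAtMost_iff)
qed

text \<open>The matrix entries identify the endomorphisms with the affine space, so a set of endomorphisms that
is cut out by a condition on the matrix has exactly the matrices with this condition as its image.\<close>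
lemma matrix_entries_image:
  assumes "\<And>T. T \<in> A \<longleftrightarrow> Vector_Spaces.linear scale scale T \<and> matrix_entries scale n e T \<in> S"
    and "S \<subseteq> {1..n} \<times> {1..n} \<rightarrow>\<^sub>E UNIV"
  shows "matrix_entries scale n e ` A = S"
proof
  show "matrix_entries scale n e ` A \<subseteq> S" using assms(1) by blast
  show "S \<subseteq> matrix_entries scale n e ` A"
  proof
    fix x assume x: "x \<in> S"
    then have eq: "matrix_entries scale n e (endo (\<lambda>i j. x (i, j))) = x"
      using assms(2) by (intro matrix_entries_endo) blast
    then have "endo (\<lambda>i j. x (i, j)) \<in> A" using assms(1) linear_endo x by simp
    from imageI[OF this, of "matrix_entries scale n e"] show "x \<in> matrix_entries scale n e ` A"
      by (simp only: eq)
  qed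
qed

text \<open>The Rota--Baxter identity for two basis vectors. The products on the right collapse because
multiplication by \<open>e i\<close> only sees the coordinate \<open>i\<close>.\<close>
lemma RB0_coords:
  assumes R: "R \<in> RB0 scale mul" and i: "i \<in> {1..n}" and j: "j \<in> {1..n}"
  shows "(\<Sum>l = 1..n. coord l (R (e i)) * coord l (R (e j)) * coord p (e l \<bullet> e l))
    = coord j (R (e i)) * coord p (R (e j \<bullet> e j)) + coord i (R (e j)) * coord p (R (e i \<bullet> e i))"
proof -
  have lin: "Vector_Spaces.linear scale scale R" and eq: "R (e i) \<bullet> R (e j) = R (R (e i) \<bullet> e j + e i \<bullet> R (e j))"
    using R unfolding RB0_def by blast+
  interpret R: Vector_Spaces.linear scale scale R by (rule lin)
  have "(\<Sum>l = 1..n. coord l (R (e i)) * coord l (R (e j)) * coord p (e l \<bullet> e l))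
      = coord p (R (e i) \<bullet> R (e j))"
    by (simp add: mul_expansion[of "R (e i)"] coord_sum coord_scale)
  also have "\<dots> = coord p (R (coord j (R (e i)) *s (e j \<bullet> e j) + coord i (R (e j)) *s (e i \<bullet> e i)))"
    unfolding eq mul_basis_right[OF j, of "R (e i)"] mul_basis_left[OF i, of "R (e j)"] ..
  finally show ?thesis by (simp add: R.add R.scale coord_add coord_scale)
qed

end

section \<open>Classification of the ordinary operators\<close>

text \<open>This is where characteristic zero enters the classification: the eigenvalues of an
operator form a geometric sequence with ratio two, and they must be distinct.\<close>
lemma two_power_neq_one:
  assumes "0 < d"
  shows "(2 :: 'a::field_char_0) ^ d \<noteq> 1"
proof
  assume "(2 :: 'a) ^ d = 1"
  then have "of_nat (2 ^ d) = (of_nat 1 :: 'a)" by simp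
  then have "(2 :: nat) ^ d = 1" by (simp only: of_nat_eq_iff)
  then show False using assms by simp
qed

context max_nilindex_normal_form
begin

lemma coord_square:
  assumes l: "l \<in> {1..n}" and p: "p \<in> {1..n}"
  shows "coord p (e l \<bullet> e l)
    = (if l = n then 0 else if p = l + 1 then 1 else if l + 1 < p \<and> p < n then a l p else 0)"
proof -
  have "l = n \<or> l = n - 1 \<or> l = n - 2 \<or> l \<le> n - 3" using l by auto
  then consider "l = n" | "l = n - 1" | "l = n - 2" | "l \<le> n - 3" by blast
  then show ?thesis
  proof cases
    case 1
    then show ?thesis by (simp add: square_n coord_zero)
  next
    case 2
    then show ?thesis using p n_ge_3 square_n_minus_1 by (auto simp: coord_basis)
  next
    case 3
    then show ?thesis using p n_ge_3 square_n_minus_2 by (auto simp: coord_basis)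
  next
    case 4
    have "e l \<bullet> e l = e (l + 1) + (\<Sum>j = l + 2..n - 1. a l j *s e j)"
      using 4 l by (intro square) auto
    then have "coord p (e l \<bullet> e l)
        = (if p = l + 1 then 1 else 0) + (\<Sum>j = l + 2..n - 1. a l j * coord p (e j))"
      using 4 p n_ge_3 by (auto simp: coord_add coord_sum coord_scale coord_basis)
    also have "(\<Sum>j = l + 2..n - 1. a l j * coord p (e j))
        = (\<Sum>j = l + 2..n - 1. if j = p then a l p else 0)"
      using p n_ge_3 by (intro sum.cong) (auto simp: coord_basis)
    also have "\<dots> = (if l + 1 < p \<and> p < n then a l p else 0)" by auto
    finally show ?thesis using 4 n_ge_3 by auto
  qed
qed

text \<open>The squares of the basis vectors are unitriangular: the lowest basis vector in \<open>e l \<bullet> e l\<close> is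
\<open>e (l + 1)\<close>. Hence the coefficients of a linear combination of them vanish one after
the other, and here these coefficients are squares of field elements.\<close>
lemma squares_combination_zero:
  assumes zero: "\<And>p. 1 \<le> p \<Longrightarrow> p \<le> P \<Longrightarrow> (\<Sum>l = 1..n. y l * y l * coord p (e l \<bullet> e l)) = 0"
    and "P \<le> n" "1 \<le> l" "l < P"
  shows "y l = 0"
  using assms(3,4)
proof (induction l rule: less_induct)
  case (less l)
  have "(\<Sum>l' = 1..n. y l' * y l' * coord (l + 1) (e l' \<bullet> e l'))
      = (\<Sum>l'\<in>{l}. y l' * y l' * coord (l + 1) (e l' \<bullet> e l'))"
  proof (rule sum.mono_neutral_right)
    show "\<forall>l'\<in>{1..n} - {l}. y l' * y l' * coord (l + 1) (e l' \<bullet> e l') = 0"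
    proof
      fix l' assume l': "l' \<in> {1..n} - {l}"
      show "y l' * y l' * coord (l + 1) (e l' \<bullet> e l') = 0"
        using l' less.prems less.IH[of l'] \<open>P \<le> n\<close> by (cases "l' < l") (auto simp: coord_square)
    qed
  qed (use less.prems \<open>P \<le> n\<close> in auto)
  also have "\<dots> = y l * y l" using less.prems \<open>P \<le> n\<close> by (simp add: coord_square)
  finally show ?case using zero[of "l + 1"] less.prems by simp
qed

text \<open>These linear conditions on the matrix describe the closure of \<open>W k\<close>: the case in which the
eigenvalue on \<open>e n\<close> vanishes is included, and for \<open>k = n\<close> the conditions describe \<open>V0\<close>.
In this way all families become linear subspaces of the same kind.\<close>
definition ordinary_shape :: "nat \<Rightarrow> ('v \<Rightarrow> 'v) \<Rightarrow> bool" where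
  "ordinary_shape k T \<longleftrightarrow>
     (\<forall>i\<in>{1..<n}. \<forall>j\<in>{1..n}. coord i (T (e j))
        = (if i = j \<and> k \<le> i then 2 ^ (n - i) * coord n (T (e n)) else 0))
     \<and> (\<forall>j. k < j \<and> j < n \<longrightarrow> coord n (T (e j)) = 0)"

text \<open>The shape of local operators. In contrast to ordinary operators, the last row of the matrix is
arbitrary; in particular the entry at \<open>(n, n)\<close> is independent of the other diagonal entries.
Therefore the entry at \<open>(n - 1, n - 1)\<close> serves as the parameter for the diagonal.\<close>
definition local_shape :: "nat \<Rightarrow> ('v \<Rightarrow> 'v) \<Rightarrow> bool" where
  "local_shape k T \<longleftrightarrow>
     (\<forall>i\<in>{1..<n}. \<forall>j\<in>{1..n}. coord i (T (e j))
        = (if i = j \<and> k \<le> i then 2 ^ (n - 1 - i) * coord (n - 1) (T (e (n - 1))) else 0))"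

text \<open>What the Rota--Baxter identity says about the column \<open>j\<close> when all later columns are known: apart from
the last row, the column is concentrated on the diagonal, and a nonzero diagonal entry doubles
the next one, excludes obstructions in row \<open>j\<close> of the structure constants, and forces the entry
of the next column in the last row to vanish, unless that column is the last one.\<close>
definition rigid_column :: "('v \<Rightarrow> 'v) \<Rightarrow> nat \<Rightarrow> bool" where
  "rigid_column R j \<longleftrightarrow>
     (\<forall>l\<in>{1..<n}. l \<noteq> j \<longrightarrow> coord l (R (e j)) = 0)
     \<and> (j < n \<and> coord j (R (e j)) \<noteq> 0 \<longrightarrow>
          coord j (R (e j)) = 2 * coord (j + 1) (R (e (j + 1)))
          \<and> (\<forall>p. j + 1 < p \<and> p < n \<longrightarrow> a j p = 0)
          \<and> (j + 1 < n \<longrightarrow> coord n (R (e (j + 1))) = 0))"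

lemma diagonal_chain:
  assumes good: "\<And>j. i \<le> j \<Longrightarrow> j < n \<Longrightarrow> rigid_column R j"
    and nz: "coord i (R (e i)) \<noteq> 0" and "i \<le> j" "j \<le> n"
  shows "coord j (R (e j)) \<noteq> 0 \<and> coord i (R (e i)) = 2 ^ (j - i) * coord j (R (e j))"
  using assms(3,4)
proof (induction j rule: dec_induct)
  case base
  then show ?case using nz by simp
next
  case (step j)
  then have IH: "coord j (R (e j)) \<noteq> 0" "coord i (R (e i)) = 2 ^ (j - i) * coord j (R (e j))" by auto
  then have next_eq: "coord j (R (e j)) = 2 * coord (Suc j) (R (e (Suc j)))"
    using good[of j] step by (auto simp: rigid_column_def)
  then show ?case using IH step by (auto simp: Suc_diff_le)
qed

text \<open>The coordinates up to \<open>i\<close> of the identity for \<open>e i, e i\<close> show that the column vanishes above the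
diagonal. The coordinate \<open>i + 1\<close> leaves two possibilities for the diagonal entry: zero, in which
case the squares of all entries combine to zero, or twice the next diagonal entry. In the latter
case the mixed identities for \<open>e i, e j\<close> annihilate the entries below the diagonal, and then
the remaining coordinates of the identity for \<open>e i, e i\<close> compare the diagonal entry at \<open>i\<close> with the
one at \<open>p\<close>: a nonzero structure constant \<open>a i p\<close> would require the ratio two where it
is a higher power of two.\<close>
lemma rigid_column_step:
  assumes R: "R \<in> RB0 scale mul" and i: "1 \<le> i" "i \<le> n"
    and good: "\<And>j. i < j \<Longrightarrow> j \<le> n \<Longrightarrow> rigid_column R j"
  shows "rigid_column R i"
proof -
  define r where "r p q = coord p (R (e q))" for p q
  define b where "b l p = coord p (e l \<bullet> e l)" for l p
  have lin: "Vector_Spaces.linear scale scale R" using R by (simp add: RB0_def)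
  have eq: "(\<Sum>l = 1..n. r l i * r l j * b l p)
      = r j i * (\<Sum>q = 1..n. b j q * r p q) + r i j * (\<Sum>q = 1..n. b i q * r p q)"
    if "j \<in> {1..n}" for j p
    unfolding r_def b_def using RB0_coords[OF R, of i j p] i that
    by (simp add: coord_linear[OF lin, of p "e _ \<bullet> e _"])
  have b: "b l p = (if l = n then 0 else if p = l + 1 then 1 else if l + 1 < p \<and> p < n then a l p else 0)"
    if "l \<in> {1..n}" "p \<in> {1..n}" for l p
    unfolding b_def using that by (rule coord_square)
  have off: "r p q = 0" if "i < q" "q \<le> n" "1 \<le> p" "p < n" "p \<noteq> q" for p q
    using good[of q] that by (auto simp: rigid_column_def r_def)
  have low_sum: "(\<Sum>q = 1..n. b i q * r p q) = 0" if "1 \<le> p" "p \<le> i" for p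
  proof (rule sum.neutral, intro ballI)
    fix q assume q: "q \<in> {1..n}"
    show "b i q * r p q = 0"
      using q i that b[of i q] off[of q p] by (cases "i < q") auto
  qed
  have low: "r l i = 0" if "1 \<le> l" "l < i" for l
  proof (rule squares_combination_zero[where P = i and y = "\<lambda>l. r l i"])
    fix p assume "1 \<le> p" "p \<le> i"
    then show "(\<Sum>l = 1..n. r l i * r l i * coord p (e l \<bullet> e l)) = 0"
      using eq[of i p] i low_sum by (simp add: b_def)
  qed (use that i in auto)
  show ?thesis
  proof (cases "i = n")
    case True
    then show ?thesis using low by (auto simp: rigid_column_def r_def)
  next
    case False
    then have "i < n" using i by simp
    have diag_sum: "(\<Sum>q = 1..n. b j q * r (j + 1) q) = r (j + 1) (j + 1)" if "i \<le> j" "j < n" for j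
    proof -
      have "(\<Sum>q = 1..n. b j q * r (j + 1) q) = (\<Sum>q\<in>{j + 1}. b j q * r (j + 1) q)"
      proof (rule sum.mono_neutral_right)
        show "\<forall>q\<in>{1..n} - {j + 1}. b j q * r (j + 1) q = 0"
        proof
          fix q assume "q \<in> {1..n} - {j + 1}"
          then show "b j q * r (j + 1) q = 0"
            using that i b[of j q] off[of q "j + 1"] by (cases "j < q") auto
        qed
      qed (use that in auto)
      then show ?thesis using that i b[of j "j + 1"] by simp
    qed
    have "(\<Sum>l = 1..n. r l i * r l i * b l (i + 1)) = (\<Sum>l\<in>{i}. r l i * r l i * b l (i + 1))"
    proof (rule sum.mono_neutral_right)
      show "\<forall>l\<in>{1..n} - {i}. r l i * r l i * b l (i + 1) = 0"
      proof
        fix l assume "l \<in> {1..n} - {i}"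
        then show "r l i * r l i * b l (i + 1) = 0"
          using \<open>i < n\<close> b[of l "i + 1"] low[of l] by (cases "l < i") auto
      qed
    qed (use i in auto)
    then have "r i i * r i i = 2 * r i i * r (i + 1) (i + 1)"
      using eq[of i "i + 1"] i \<open>i < n\<close> b[of i "i + 1"] diag_sum[of i] by simp
    then have dichotomy: "r i i = 0 \<or> r i i = 2 * r (i + 1) (i + 1)" by auto
    show ?thesis
    proof (cases "r i i = 0")
      case True
      have "r l i = 0" if "1 \<le> l" "l < n" for l
      proof (rule squares_combination_zero[where P = n and y = "\<lambda>l. r l i"])
        fix p assume "1 \<le> p" "p \<le> n"
        then show "(\<Sum>l = 1..n. r l i * r l i * coord p (e l \<bullet> e l)) = 0"
          using eq[of i p] i True by (simp add: b_def)
      qed (use that in auto)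
      then show ?thesis using True by (auto simp: rigid_column_def r_def)
    next
      case nz: False
      then have double: "r i i = 2 * r (i + 1) (i + 1)" using dichotomy by simp
      have chain: "r j j \<noteq> 0 \<and> r i i = 2 ^ (j - i) * r j j" if "i < j" "j \<le> n" for j
      proof -
        have "r j j \<noteq> 0 \<and> r (i + 1) (i + 1) = 2 ^ (j - (i + 1)) * r j j"
          unfolding r_def
        proof (rule diagonal_chain)
          show "coord (i + 1) (R (e (i + 1))) \<noteq> 0" using nz double by (auto simp: r_def)
        qed (use that good in auto)
        moreover have "j - i = Suc (j - (i + 1))" using that by simp
        ultimately show ?thesis using double by simp
      qed
      have high: "r j i = 0" if "i < j" "j < n" for j
      proof -
        have "(\<Sum>l = 1..n. r l i * r l j * b l (j + 1)) = (\<Sum>l\<in>{j}. r l i * r l j * b l (j + 1))"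
        proof (rule sum.mono_neutral_right)
          show "\<forall>l\<in>{1..n} - {j}. r l i * r l j * b l (j + 1) = 0"
          proof
            fix l assume "l \<in> {1..n} - {j}"
            then show "r l i * r l j * b l (j + 1) = 0"
              using that b[of l "j + 1"] off[of j l] by (cases "l = n") auto
          qed
        qed (use i that in auto)
        then have "r j i * r j j = r j i * r (j + 1) (j + 1)"
          using eq[of j "j + 1"] i that b[of j "j + 1"] diag_sum[of j] off[of j i] by simp
        moreover have "r j j = 2 * r (j + 1) (j + 1)" "r (j + 1) (j + 1) \<noteq> 0"
          using good[of j] chain[of j] chain[of "j + 1"] that by (auto simp: rigid_column_def r_def)
        ultimately show ?thesis by auto
      qed
      have col: "r l i = 0" if "1 \<le> l" "l < n" "l \<noteq> i" for l
        using low[of l] high[of l] that by (cases "l < i") auto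
      have lhs: "(\<Sum>l = 1..n. r l i * r l i * b l p) = r i i * r i i * b i p" if "p \<in> {1..n}" for p
      proof -
        have "(\<Sum>l = 1..n. r l i * r l i * b l p) = (\<Sum>l\<in>{i}. r l i * r l i * b l p)"
        proof (rule sum.mono_neutral_right)
          show "\<forall>l\<in>{1..n} - {i}. r l i * r l i * b l p = 0"
          proof
            fix l assume "l \<in> {1..n} - {i}"
            then show "r l i * r l i * b l p = 0"
              using that b[of l p] col[of l] by (cases "l = n") auto
          qed
        qed (use i in auto)
        then show ?thesis by simp
      qed
      have no_obstruction: "a i p = 0" if p: "i + 1 < p" "p < n" for p
      proof (rule ccontr)
        assume a: "a i p \<noteq> 0"
        have "(\<Sum>q = 1..n. b i q * r p q) = (\<Sum>q\<in>{p}. b i q * r p q)"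
        proof (rule sum.mono_neutral_right)
          show "\<forall>q\<in>{1..n} - {p}. b i q * r p q = 0"
          proof
            fix q assume "q \<in> {1..n} - {p}"
            then show "b i q * r p q = 0"
              using p i b[of i q] off[of q p] by (cases "i < q") auto
          qed
        qed (use p in auto)
        then have "r i i * r i i * a i p = 2 * r i i * a i p * r p p"
          using eq[of i p] lhs[of p] i p b[of i p] by auto
        then have "(r i i * a i p) * r i i = (r i i * a i p) * (2 * r p p)" by (simp add: ac_simps)
        then have "r i i = 2 * r p p" using a nz by (simp only: mult_cancel_left) simp
        moreover obtain d where d: "p - i = Suc d" "0 < d" using p by (cases "p - i") auto
        moreover have "r i i = 2 ^ (p - i) * r p p" "r p p \<noteq> 0" using chain[of p] p by auto
        ultimately have "(2 :: 'a) ^ d = 1" by simp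
        then show False using two_power_neq_one[where 'a = 'a, OF d(2)] by simp
      qed
      have "r n (i + 1) = 0" if "i + 1 < n"
      proof -
        have "(\<Sum>q = 1..n. b i q * r n q) = (\<Sum>q\<in>{i + 1}. b i q * r n q)"
        proof (rule sum.mono_neutral_right)
          show "\<forall>q\<in>{1..n} - {i + 1}. b i q * r n q = 0"
          proof
            fix q assume "q \<in> {1..n} - {i + 1}"
            then show "b i q * r n q = 0" using i b[of i q] no_obstruction[of q] by auto
          qed
        qed (use that in auto)
        then show ?thesis
          using eq[of i n] lhs[of n] i that nz b[of i n] b[of i "i + 1"] by simp
      qed
      then show ?thesis using col double no_obstruction by (auto simp: rigid_column_def r_def)
    qed
  qed
qed

lemma rigid_columns:
  assumes "R \<in> RB0 scale mul" "1 \<le> j" "j \<le> n"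
  shows "rigid_column R j"
  using assms(2,3)
proof (induction "n - j" arbitrary: j rule: less_induct)
  case less
  show ?case
  proof (rule rigid_column_step[OF assms(1) less.prems])
    fix j' assume "j < j'" "j' \<le> n"
    then show "rigid_column R j'" using less.prems by (intro less.hyps) auto
  qed
qed

lemma finite_obstruction_rows: "finite {i. \<exists>j. (i, j) \<in> obstruction_set n a}"
  by (rule finite_subset[of _ "{..n}"]) (auto simp: obstruction_set_def)

lemma obstruction_le_index: "(i, j) \<in> obstruction_set n a \<Longrightarrow> i \<le> obstruction_index n a"
  unfolding obstruction_index_def by (auto intro!: Max_ge finite_obstruction_rows)

lemma obstruction_index_attained:
  assumes "0 < obstruction_index n a"
  shows "\<exists>j. (obstruction_index n a, j) \<in> obstruction_set n a"
proof -
  have ne: "obstruction_set n a \<noteq> {}" using assms by (auto simp: obstruction_index_def)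
  then have "{i. \<exists>j. (i, j) \<in> obstruction_set n a} \<noteq> {}" by auto
  from Max_in[OF finite_obstruction_rows this] ne show ?thesis
    by (simp add: obstruction_index_def)
qed

lemma obstruction_index_less: "obstruction_index n a < n - 2"
  using obstruction_index_attained n_ge_3
  by (cases "obstruction_index n a = 0") (auto simp: obstruction_set_def)

text \<open>The index \<open>k\<close> is the first one with a nonzero diagonal entry, or \<open>n\<close> if there is none below \<open>n\<close>.
From \<open>k\<close> on all diagonal entries are nonzero, so that the rows from \<open>k\<close> on carry no obstruction
and \<open>k\<close> exceeds the obstruction index.\<close>
lemma RB0_imp_ordinary_shape:
  assumes R: "R \<in> RB0 scale mul"
  shows "\<exists>k\<in>{obstruction_index n a + 1..n}. ordinary_shape k R"
proof -
  let ?D = "{j \<in> {1..n}. j = n \<or> coord j (R (e j)) \<noteq> 0}"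
  define k where "k = Min ?D"
  have "?D \<noteq> {}" using n_ge_3 by auto
  then have "k \<in> ?D" unfolding k_def by (intro Min_in) auto
  then have k: "1 \<le> k" "k \<le> n" "k = n \<or> coord k (R (e k)) \<noteq> 0" by auto
  have below: "coord i (R (e i)) = 0" if "1 \<le> i" "i < k" for i
  proof (rule ccontr)
    assume "coord i (R (e i)) \<noteq> 0"
    then have "i \<in> ?D" using that k by auto
    then have "k \<le> i" unfolding k_def by (intro Min_le) auto
    then show False using that by simp
  qed
  have good: "rigid_column R j" if "1 \<le> j" "j \<le> n" for j using rigid_columns[OF R that] .
  have nz: "coord i (R (e i)) \<noteq> 0" if "k \<le> i" "i < n" for i
    using diagonal_chain[of k R i] good k that by auto
  have diag: "coord i (R (e i)) = 2 ^ (n - i) * coord n (R (e n))" if "k \<le> i" "i < n" for i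
    using diagonal_chain[of i R n] good k nz[OF that] that by auto
  have "ordinary_shape k R"
    unfolding ordinary_shape_def
  proof (intro conjI ballI allI impI)
    fix i j assume "i \<in> {1..<n}" "j \<in> {1..n}"
    then show "coord i (R (e j)) = (if i = j \<and> k \<le> i then 2 ^ (n - i) * coord n (R (e n)) else 0)"
      using below[of i] diag[of i] good[of j] by (cases "i = j") (auto simp: rigid_column_def)
  next
    fix j assume "k < j \<and> j < n"
    then show "coord n (R (e j)) = 0"
      using good[of "j - 1"] nz[of "j - 1"] k by (auto simp: rigid_column_def)
  qed
  moreover have "obstruction_index n a < k"
  proof (rule ccontr)
    assume le: "\<not> obstruction_index n a < k"
    then obtain j where "(obstruction_index n a, j) \<in> obstruction_set n a"
      using obstruction_index_attained k by fastforce
    then show False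
      using good[of "obstruction_index n a"] nz[of "obstruction_index n a"] le
      by (auto simp: rigid_column_def obstruction_set_def)
  qed
  ultimately show ?thesis using k by auto
qed

lemma square_unobstructed:
  assumes "obstruction_index n a < l" "l < n"
  shows "e l \<bullet> e l = e (l + 1)"
proof (rule coord_eqI)
  fix p assume p: "1 \<le> p" "p \<le> n"
  have "a l p = 0" if "l + 1 < p" "p < n"
    using obstruction_le_index[of l p] that assms by (auto simp: obstruction_set_def)
  then show "coord p (e l \<bullet> e l) = coord p (e (l + 1))"
    using assms p by (auto simp: coord_square coord_basis)
qed

lemma coord_ordinary_shape:
  assumes "Vector_Spaces.linear scale scale T" "ordinary_shape k T" "i \<in> {1..<n}"
  shows "coord i (T x) = (if k \<le> i then 2 ^ (n - i) * coord n (T (e n)) else 0) * coord i x"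
proof -
  have "coord i (T x) = (\<Sum>j = 1..n. if j = i then
      (if k \<le> i then 2 ^ (n - i) * coord n (T (e n)) else 0) * coord i x else 0)"
    unfolding coord_linear[OF assms(1), of i x] using assms(2,3)
    by (intro sum.cong) (auto simp: ordinary_shape_def)
  then show ?thesis using assms(3) by simp
qed

text \<open>Both sides of the identity are combinations of \<open>e l \<bullet> e l\<close> and \<open>R (e l \<bullet> e l)\<close> with coefficients
that are products of coordinates of the arguments. It therefore suffices to compare them for each
\<open>l\<close>: the square of \<open>e n\<close> is zero, for \<open>l < k\<close> the eigenvalue is zero, and for \<open>k \<le> l < n\<close> the square \<open>e l \<bullet> e l\<close> is the
eigenvector \<open>e (l + 1)\<close>, whose eigenvalue is half the one of \<open>e l\<close>.\<close>
lemma ordinary_shape_imp_RB0: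
  assumes lin: "Vector_Spaces.linear scale scale R" and shape: "ordinary_shape k R"
    and k: "obstruction_index n a < k"
  shows "R \<in> RB0 scale mul"
proof -
  interpret R: Vector_Spaces.linear scale scale R by (rule lin)
  define \<alpha> where "\<alpha> = coord n (R (e n))"
  define \<mu> where "\<mu> i = (if k \<le> i then 2 ^ (n - i) * \<alpha> else 0)" for i
  have coord_R: "coord i (R x) = \<mu> i * coord i x" if "i \<in> {1..<n}" for i x
    using coord_ordinary_shape[OF lin shape that] by (simp add: \<mu>_def \<alpha>_def)
  have key: "(\<mu> l * \<mu> l) *s (e l \<bullet> e l) = (2 * \<mu> l) *s R (e l \<bullet> e l)" if l: "l \<in> {1..<n}" for l
  proof (cases "k \<le> l")
    case True
    have sq: "e l \<bullet> e l = e (l + 1)" using True k l by (intro square_unobstructed) auto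
    have "R (e (l + 1)) = \<mu> (l + 1) *s e (l + 1)"
    proof (rule coord_eqI)
      fix p assume p: "1 \<le> p" "p \<le> n"
      show "coord p (R (e (l + 1))) = coord p (\<mu> (l + 1) *s e (l + 1))"
      proof (cases "p = n")
        case False
        then show ?thesis using p coord_R[of p "e (l + 1)"] l by (auto simp: coord_scale coord_basis)
      next
        case pn: True
        show ?thesis
        proof (cases "l + 1 = n")
          case True
          then show ?thesis using pn \<open>k \<le> l\<close> n_ge_3 by (simp add: coord_scale coord_basis \<mu>_def \<alpha>_def)
        next
          case False
          then have "coord n (R (e (l + 1))) = 0"
            using shape \<open>k \<le> l\<close> l by (auto simp: ordinary_shape_def)
          then show ?thesis using pn False l by (simp add: coord_scale coord_basis)
        qed
      qed
    qed
    moreover have "\<mu> l = 2 * \<mu> (l + 1)"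
    proof -
      have "n - l = Suc (n - (l + 1))" using l by auto
      then show ?thesis using True by (simp add: \<mu>_def)
    qed
    ultimately show ?thesis unfolding sq by simp
  qed (simp add: \<mu>_def)
  have "R x \<bullet> R y = R (R x \<bullet> y + x \<bullet> R y)" for x y
  proof -
    have "R x \<bullet> R y = (\<Sum>l = 1..n. (coord l x * coord l y) *s ((\<mu> l * \<mu> l) *s (e l \<bullet> e l)))"
      unfolding mul_expansion[of "R x" "R y"]
    proof (rule sum.cong)
      fix l assume "l \<in> {1..n}"
      then show "(coord l (R x) * coord l (R y)) *s (e l \<bullet> e l)
          = (coord l x * coord l y) *s ((\<mu> l * \<mu> l) *s (e l \<bullet> e l))"
        by (cases "l = n") (simp_all add: square_n coord_R ac_simps)
    qed simp
    also have "\<dots> = (\<Sum>l = 1..n. (coord l x * coord l y) *s ((2 * \<mu> l) *s R (e l \<bullet> e l)))"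
    proof (rule sum.cong)
      fix l assume "l \<in> {1..n}"
      then show "(coord l x * coord l y) *s ((\<mu> l * \<mu> l) *s (e l \<bullet> e l))
          = (coord l x * coord l y) *s ((2 * \<mu> l) *s R (e l \<bullet> e l))"
        using key[of l] by (cases "l = n") (simp_all add: square_n R.zero)
    qed simp
    also have "\<dots> = R (\<Sum>l = 1..n. (coord l (R x) * coord l y + coord l x * coord l (R y)) *s (e l \<bullet> e l))"
      unfolding R.sum
    proof (rule sum.cong)
      fix l assume "l \<in> {1..n}"
      then show "(coord l x * coord l y) *s ((2 * \<mu> l) *s R (e l \<bullet> e l))
          = R ((coord l (R x) * coord l y + coord l x * coord l (R y)) *s (e l \<bullet> e l))"
        by (cases "l = n") (simp_all add: square_n R.zero coord_R R.scale algebra_simps)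
    qed simp
    also have "\<dots> = R (R x \<bullet> y + x \<bullet> R y)"
      by (simp add: mul_expansion[of "R x" y] mul_expansion[of x "R y"] scale_left_distrib sum.distrib)
    finally show ?thesis .
  qed
  then show ?thesis using lin by (simp add: RB0_def)
qed

lemma RB0_iff_ordinary_shape:
  "R \<in> RB0 scale mul \<longleftrightarrow> Vector_Spaces.linear scale scale R
     \<and> (\<exists>k\<in>{obstruction_index n a + 1..n}. ordinary_shape k R)"
  using RB0_imp_ordinary_shape ordinary_shape_imp_RB0 by (auto simp: RB0_def)

lemma V0_iff_ordinary_shape:
  "T \<in> V0 scale n e \<longleftrightarrow> Vector_Spaces.linear scale scale T \<and> ordinary_shape n T"
proof -
  have "(\<exists>c. \<forall>i\<in>{1..n}. T (e i) = c i *s e n) \<longleftrightarrow> ordinary_shape n T"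
  proof
    assume "\<exists>c. \<forall>i\<in>{1..n}. T (e i) = c i *s e n"
    then show "ordinary_shape n T" by (auto simp: ordinary_shape_def coord_scale coord_basis)
  next
    assume shape: "ordinary_shape n T"
    have "T (e i) = coord n (T (e i)) *s e n" if "i \<in> {1..n}" for i
    proof (rule coord_eqI)
      fix p assume "1 \<le> p" "p \<le> n"
      then show "coord p (T (e i)) = coord p (coord n (T (e i)) *s e n)"
        using shape that by (cases "p = n") (auto simp: ordinary_shape_def coord_scale coord_basis)
    qed
    then show "\<exists>c. \<forall>i\<in>{1..n}. T (e i) = c i *s e n"
      by (intro exI[of _ "\<lambda>i. coord n (T (e i))"] ballI)
  qed
  then show ?thesis by (simp add: V0_def)
qed

lemma W_iff_ordinary_shape:
  assumes k: "1 \<le> k" "k < n"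
  shows "T \<in> W scale n e k \<longleftrightarrow>
    Vector_Spaces.linear scale scale T \<and> ordinary_shape k T \<and> coord n (T (e n)) \<noteq> 0"
proof
  assume "T \<in> W scale n e k"
  then obtain \<alpha> c where lin: "Vector_Spaces.linear scale scale T" and "\<alpha> \<noteq> 0"
    and T: "\<And>i. i \<in> {1..n} \<Longrightarrow> T (e i) =
        (if i < k then c i *s e n
         else if i = k then (2 ^ (n - k) * \<alpha>) *s e k + c k *s e n
         else if i < n then (2 ^ (n - i) * \<alpha>) *s e i
         else \<alpha> *s e n)"
    unfolding W_def by blast
  have T_n: "coord n (T (e n)) = \<alpha>" using T[of n] k by (simp add: coord_scale coord_basis)
  have shape: "ordinary_shape k T"
    unfolding ordinary_shape_def T_n
  proof (intro conjI ballI allI impI)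
    fix i j assume "i \<in> {1..<n}" "j \<in> {1..n}"
    then show "coord i (T (e j)) = (if i = j \<and> k \<le> i then 2 ^ (n - i) * \<alpha> else 0)"
      using k unfolding T[OF \<open>j \<in> {1..n}\<close>] by (auto simp: coord_add coord_scale coord_basis)
  next
    fix j assume "k < j \<and> j < n"
    then show "coord n (T (e j)) = 0" using T[of j] k by (simp add: coord_scale coord_basis)
  qed
  show "Vector_Spaces.linear scale scale T \<and> ordinary_shape k T \<and> coord n (T (e n)) \<noteq> 0"
    unfolding T_n by (intro conjI lin shape \<open>\<alpha> \<noteq> 0\<close>)
next
  assume "Vector_Spaces.linear scale scale T \<and> ordinary_shape k T \<and> coord n (T (e n)) \<noteq> 0"
  then have lin: "Vector_Spaces.linear scale scale T" and shape: "ordinary_shape k T"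
    and nz: "coord n (T (e n)) \<noteq> 0" by blast+
  define \<alpha> where "\<alpha> = coord n (T (e n))"
  define c where "c i = coord n (T (e i))" for i
  have entry: "coord p (T (e i)) = (if p = n then (if i = n then \<alpha> else if i \<le> k then c i else 0)
      else if p = i \<and> k \<le> i then 2 ^ (n - i) * \<alpha> else 0)" if "p \<in> {1..n}" "i \<in> {1..n}" for p i
  proof (cases "p = n")
    case True
    have "coord n (T (e i)) = 0" if "k < i" "i < n"
      using shape that unfolding ordinary_shape_def by blast
    then show ?thesis using True \<open>i \<in> {1..n}\<close> by (simp add: \<alpha>_def c_def)
  next
    case False
    then have "p \<in> {1..<n}" using \<open>p \<in> {1..n}\<close> by simp
    then have "coord p (T (e i)) = (if p = i \<and> k \<le> p then 2 ^ (n - p) * \<alpha> else 0)"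
      using shape \<open>i \<in> {1..n}\<close> unfolding ordinary_shape_def \<alpha>_def by blast
    then show ?thesis using False by simp
  qed
  have "T (e i) =
      (if i < k then c i *s e n
       else if i = k then (2 ^ (n - k) * \<alpha>) *s e k + c k *s e n
       else if i < n then (2 ^ (n - i) * \<alpha>) *s e i
       else \<alpha> *s e n)" if i: "i \<in> {1..n}" for i
  proof (rule coord_eqI)
    fix p assume "1 \<le> p" "p \<le> n"
    then have p: "p \<in> {1..n}" by simp
    show "coord p (T (e i)) = coord p
      (if i < k then c i *s e n
       else if i = k then (2 ^ (n - k) * \<alpha>) *s e k + c k *s e n
       else if i < n then (2 ^ (n - i) * \<alpha>) *s e i
       else \<alpha> *s e n)"
      unfolding entry[OF p i] using p i k by (auto simp: coord_add coord_scale coord_basis)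
  qed
  then have "\<forall>i\<in>{1..n}. T (e i) =
      (if i < k then c i *s e n
       else if i = k then (2 ^ (n - k) * \<alpha>) *s e k + c k *s e n
       else if i < n then (2 ^ (n - i) * \<alpha>) *s e i
       else \<alpha> *s e n)" by (rule ballI)
  moreover have "\<alpha> \<noteq> 0" using nz by (simp add: \<alpha>_def)
  ultimately show "T \<in> W scale n e k"
    using lin unfolding W_def by blast
qed

lemma ordinary_shape_degenerate:
  assumes "ordinary_shape k T" "coord n (T (e n)) = 0"
  shows "ordinary_shape n T"
  using assms by (auto simp: ordinary_shape_def)

lemma RB0_eq_V0_union_W:
  "RB0 scale mul = V0 scale n e \<union> (\<Union>k\<in>{obstruction_index n a + 1..n - 1}. W scale n e k)"
proof (rule set_eqI)
  fix T
  have "(\<exists>k\<in>{obstruction_index n a + 1..n}. ordinary_shape k T) \<longleftrightarrow> ordinary_shape n T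
      \<or> (\<exists>k\<in>{obstruction_index n a + 1..n - 1}. ordinary_shape k T \<and> coord n (T (e n)) \<noteq> 0)"
    (is "?L \<longleftrightarrow> ?R")
  proof
    assume ?L
    then obtain k where k: "k \<in> {obstruction_index n a + 1..n}" "ordinary_shape k T" by blast
    show ?R
    proof (cases "k = n \<or> coord n (T (e n)) = 0")
      case True
      then show ?thesis using k ordinary_shape_degenerate by blast
    next
      case False
      then have "k \<in> {obstruction_index n a + 1..n - 1}" using k by auto
      then show ?thesis using k False by blast
    qed
  next
    assume ?R
    moreover have "n \<in> {obstruction_index n a + 1..n}" using obstruction_index_less by simp
    ultimately show ?L by fastforce
  qed
  moreover have "(\<exists>k\<in>{obstruction_index n a + 1..n - 1}. T \<in> W scale n e k) \<longleftrightarrow>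
      Vector_Spaces.linear scale scale T
      \<and> (\<exists>k\<in>{obstruction_index n a + 1..n - 1}. ordinary_shape k T \<and> coord n (T (e n)) \<noteq> 0)"
  proof -
    have "T \<in> W scale n e k \<longleftrightarrow>
        Vector_Spaces.linear scale scale T \<and> ordinary_shape k T \<and> coord n (T (e n)) \<noteq> 0"
      if "k \<in> {obstruction_index n a + 1..n - 1}" for k
      using that n_ge_3 by (intro W_iff_ordinary_shape) auto
    then have "(\<exists>k\<in>{obstruction_index n a + 1..n - 1}. T \<in> W scale n e k) \<longleftrightarrow>
      (\<exists>k\<in>{obstruction_index n a + 1..n - 1}. Vector_Spaces.linear scale scale T
        \<and> ordinary_shape k T \<and> coord n (T (e n)) \<noteq> 0)"
      by (intro bex_cong refl)
    then show ?thesis by (simp only: bex_simps)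
  qed
  ultimately show "T \<in> RB0 scale mul \<longleftrightarrow>
      T \<in> V0 scale n e \<union> (\<Union>k\<in>{obstruction_index n a + 1..n - 1}. W scale n e k)"
    by (simp only: RB0_iff_ordinary_shape Un_iff UN_iff V0_iff_ordinary_shape conj_disj_distribL)
qed

lemma V0_W_disjoint:
  assumes "1 \<le> k" "k < n"
  shows "V0 scale n e \<inter> W scale n e k = {}"
proof -
  have False if "ordinary_shape n T" "ordinary_shape k T" "coord n (T (e n)) \<noteq> 0" for T
  proof -
    have "k \<in> {1..<n}" "k \<in> {1..n}" using assms by auto
    then have "coord k (T (e k)) = 2 ^ (n - k) * coord n (T (e n))"
      using that(2) by (simp add: ordinary_shape_def)
    moreover have "coord k (T (e k)) = 0"
      using that(1) \<open>k \<in> {1..<n}\<close> \<open>k \<in> {1..n}\<close> by (simp add: ordinary_shape_def)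
    ultimately show False using that(3) by simp
  qed
  then show ?thesis
    by (auto simp only: W_iff_ordinary_shape[OF assms] V0_iff_ordinary_shape Int_iff empty_iff)
qed

section \<open>Classification of the local operators\<close>

text \<open>At a vector \<open>x\<close> with first nonzero coordinate \<open>p\<close>, the operators of shape \<open>max k p\<close> act on \<open>x\<close> in the
same way as \<open>T\<close> up to the last coordinate. The entry of such an operator in the last row and column
\<open>p\<close> is free and adjusts the last coordinate of the image.\<close>
lemma local_shape_imp_LRB0:
  assumes lin: "Vector_Spaces.linear scale scale T" and shape: "local_shape k T"
    and k: "k \<in> {obstruction_index n a + 1..n - 1}"
  shows "T \<in> LRB0 scale mul"
proof -
  interpret T: Vector_Spaces.linear scale scale T by (rule lin)
  define \<beta> where "\<beta> = coord (n - 1) (T (e (n - 1))) / 2"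
  have coord_T: "coord i (T x) = (if k \<le> i then 2 ^ (n - i) * \<beta> else 0) * coord i x"
    if i: "i \<in> {1..<n}" for i x
  proof -
    have pow: "n - i = Suc (n - 1 - i)" using i by auto
    have eq: "2 ^ (n - i) * \<beta> = 2 ^ (n - 1 - i) * coord (n - 1) (T (e (n - 1)))"
      unfolding pow \<beta>_def by simp
    have "coord i (T (e j)) = (if i = j \<and> k \<le> i then 2 ^ (n - i) * \<beta> else 0)"
      if "j \<in> {1..n}" for j
      using shape i that unfolding local_shape_def eq by blast
    then have "coord i (T x) = (\<Sum>j = 1..n. if j = i then
        (if k \<le> i then 2 ^ (n - i) * \<beta> else 0) * coord i x else 0)"
      unfolding coord_linear[OF lin, of i x] by (intro sum.cong) auto
    then show ?thesis using i by simp
  qed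
  have "\<exists>R \<in> RB0 scale mul. T x = R x" for x
  proof (cases "\<exists>i\<in>{1..n}. coord i x \<noteq> 0")
    case False
    then have "x = 0" by (intro coord_eqI) (auto simp: coord_zero)
    moreover obtain R where R: "R \<in> RB0 scale mul"
    proof
      have "ordinary_shape n (endo (\<lambda>_ _. 0))"
        using n_ge_3 by (auto simp: ordinary_shape_def coord_endo_basis)
      then show "endo (\<lambda>_ _. 0) \<in> RB0 scale mul"
        using obstruction_index_less by (intro ordinary_shape_imp_RB0[OF linear_endo, of n]) auto
    qed
    interpret R: Vector_Spaces.linear scale scale R using R by (simp add: RB0_def)
    show ?thesis using R \<open>x = 0\<close> T.zero R.zero by (intro bexI[of _ R]) simp_all
  next
    case True
    \<comment> \<open>The first nonzero coordinate \<open>p\<close> of \<open>x\<close> governs which ordinary operators are available at \<open>x\<close>.\<close>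
    let ?D = "{i \<in> {1..n}. coord i x \<noteq> 0}"
    define p where "p = Min ?D"
    have "p \<in> ?D" unfolding p_def using True by (intro Min_in) auto
    then have p: "1 \<le> p" "p \<le> n" "coord p x \<noteq> 0" by auto
    have before: "coord i x = 0" if "1 \<le> i" "i < p" for i
    proof (rule ccontr)
      assume "coord i x \<noteq> 0"
      then have "i \<in> ?D" using that p by auto
      then have "p \<le> i" unfolding p_def by (intro Min_le) auto
      then show False using that by simp
    qed
    define k' where "k' = max k p"
    have k': "obstruction_index n a < k'" "p \<le> k'" using k by (auto simp: k'_def)
    \<comment> \<open>If \<open>x\<close> is a multiple of \<open>e n\<close>, the free entry is the eigenvalue of \<open>e n\<close> itself.\<close>
    define \<alpha> where "\<alpha> = (if p = n then coord n (T x) / coord n x else \<beta>)"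
    define c where "c = (coord n (T x) - \<alpha> * coord n x) / coord p x"
    define A where "A i j = (if i < n then if i = j \<and> k' \<le> i then 2 ^ (n - i) * \<alpha> else 0
      else if j = n then \<alpha> else if j = p then c else 0)" for i j
    define R where "R = endo A"
    have R_nn: "coord n (R (e n)) = \<alpha>" using n_ge_3 by (simp add: R_def coord_endo_basis A_def)
    have shape_R: "ordinary_shape k' R"
      unfolding ordinary_shape_def R_nn using k' by (auto simp: R_def coord_endo_basis A_def)
    have lin_R: "Vector_Spaces.linear scale scale R" by (simp add: R_def linear_endo)
    have "coord i (T x) = coord i (R x)" if i: "1 \<le> i" "i \<le> n" for i
    proof (cases "i = n")
      case False
      then have "i \<in> {1..<n}" using i by auto
      then show ?thesis
        unfolding coord_T[OF \<open>i \<in> {1..<n}\<close>] coord_ordinary_shape[OF lin_R shape_R \<open>i \<in> {1..<n}\<close>] R_nn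
        using before[of i] i by (cases "i < p") (auto simp: k'_def \<alpha>_def)
    next
      case True
      have "coord n (R x) = (\<Sum>j = 1..n. coord j x * A n j)"
        unfolding R_def using n_ge_3 by (intro coord_endo) auto
      also have "\<dots> = (\<Sum>j = 1..n. (if j = n then coord n x * \<alpha> else 0)
          + (if j = p then if p = n then 0 else coord p x * c else 0))"
        by (intro sum.cong) (auto simp: A_def)
      also have "\<dots> = coord n x * \<alpha> + (if p = n then 0 else coord p x * c)"
        using p n_ge_3 by (simp add: sum.distrib)
      also have "\<dots> = coord n (T x)" using p by (auto simp: c_def \<alpha>_def)
      finally show ?thesis using True by simp
    qed
    then have "T x = R x" by (rule coord_eqI)
    then show ?thesis using ordinary_shape_imp_RB0[OF lin_R shape_R k'(1)] by blast
  qed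
  then show ?thesis using lin by (simp add: LRB0_def)
qed

text \<open>Up to the last coordinate, every ordinary operator is diagonal. Evaluation at \<open>e j\<close> shows that the
same holds for \<open>T\<close>, and evaluation at \<open>e i + e j\<close> links the diagonal entries at \<open>i\<close> and \<open>j\<close>, since both
come from one ordinary operator.\<close>
lemma LRB0_imp_local_shape:
  assumes T: "T \<in> LRB0 scale mul"
  shows "\<exists>k\<in>{obstruction_index n a + 1..n - 1}. local_shape k T"
proof -
  have lin: "Vector_Spaces.linear scale scale T" using T by (simp add: LRB0_def)
  interpret T: Vector_Spaces.linear scale scale T by (rule lin)
  have pointwise: "\<exists>k>obstruction_index n a. \<exists>\<alpha>. \<forall>i\<in>{1..<n}.
      coord i (T x) = (if k \<le> i then 2 ^ (n - i) * \<alpha> else 0) * coord i x" for x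
  proof -
    obtain R where R: "R \<in> RB0 scale mul" "T x = R x" using T by (auto simp: LRB0_def)
    obtain k where "k \<in> {obstruction_index n a + 1..n}" "ordinary_shape k R"
      using RB0_imp_ordinary_shape[OF R(1)] by blast
    then have k: "obstruction_index n a < k" "ordinary_shape k R" by auto
    have "Vector_Spaces.linear scale scale R" using R by (simp add: RB0_def)
    from coord_ordinary_shape[OF this k(2)] show ?thesis
      unfolding R(2) using k(1) by blast
  qed
  define t where "t i = coord i (T (e i))" for i
  have off: "coord i (T (e j)) = 0" if "i \<in> {1..<n}" "j \<in> {1..n}" "i \<noteq> j" for i j
    using pointwise[of "e j"] that by (auto simp: coord_basis)
  have pair: "obstruction_index n a < i \<and> t i = 2 ^ (j - i) * t j"
    if i: "1 \<le> i" "i < j" "j < n" "t i \<noteq> 0" for i j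
  proof -
    obtain k \<alpha> where k: "obstruction_index n a < k"
      and eq: "\<And>l. l \<in> {1..<n} \<Longrightarrow> coord l (T (e i + e j))
        = (if k \<le> l then 2 ^ (n - l) * \<alpha> else 0) * coord l (e i + e j)"
      using pointwise[of "e i + e j"] by blast
    have ti: "t i = (if k \<le> i then 2 ^ (n - i) * \<alpha> else 0)"
      using eq[of i] off[of i j] i by (simp add: T.add coord_add coord_basis t_def)
    have tj: "t j = (if k \<le> j then 2 ^ (n - j) * \<alpha> else 0)"
      using eq[of j] off[of j i] i by (simp add: T.add coord_add coord_basis t_def)
    have "k \<le> i" using ti i(4) by (auto split: if_splits)
    moreover have "(2 :: 'a) ^ (n - i) = 2 ^ (j - i) * 2 ^ (n - j)"
      using i by (simp flip: power_add)
    ultimately show ?thesis using ti tj i k by simp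
  qed
  let ?D = "{i \<in> {1..n - 1}. i = n - 1 \<or> t i \<noteq> 0}"
  define k where "k = Min ?D"
  have "?D \<noteq> {}" using n_ge_3 by auto
  then have "k \<in> ?D" unfolding k_def by (intro Min_in) auto
  then have k: "1 \<le> k" "k \<le> n - 1" "k = n - 1 \<or> t k \<noteq> 0" by auto
  have below: "t i = 0" if "1 \<le> i" "i < k" for i
  proof (rule ccontr)
    assume "t i \<noteq> 0"
    then have "i \<in> ?D" using that k by auto
    then have "k \<le> i" unfolding k_def by (intro Min_le) auto
    then show False using that by simp
  qed
  have above: "t i = 2 ^ (n - 1 - i) * t (n - 1)" if "k \<le> i" "i < n" for i
  proof (cases "i = n - 1")
    case False
    then have "k < n - 1" "i < n - 1" using that by auto
    then have "t k \<noteq> 0" using k by simp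
    then have "t i \<noteq> 0" using pair[of k i] that k by (cases "i = k") auto
    then show ?thesis using pair[of i "n - 1"] that k \<open>i < n - 1\<close> by auto
  qed simp
  have "local_shape k T"
    unfolding local_shape_def
  proof (intro ballI)
    fix i j assume "i \<in> {1..<n}" "j \<in> {1..n}"
    then show "coord i (T (e j))
        = (if i = j \<and> k \<le> i then 2 ^ (n - 1 - i) * coord (n - 1) (T (e (n - 1))) else 0)"
      using off[of i j] below[of i] above[of i] by (cases "i = j") (auto simp: t_def)
  qed
  moreover have "obstruction_index n a < k"
    using k pair[of k "n - 1"] obstruction_index_less by (cases "k = n - 1") auto
  ultimately show ?thesis using k by auto
qed

lemma LRB0_iff_local_shape:
  "T \<in> LRB0 scale mul \<longleftrightarrow> Vector_Spaces.linear scale scale T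
     \<and> (\<exists>k\<in>{obstruction_index n a + 1..n - 1}. local_shape k T)"
  using LRB0_imp_local_shape local_shape_imp_LRB0 by (auto simp: LRB0_def)

end

section \<open>Dimensions of the two sets of operators\<close>

text \<open>The coefficients of the linear equations behind both shapes: off the parameters, only the diagonal
entries from \<open>k\<close> on are nonzero, and they are obtained from the parameter at \<open>(r, r)\<close> by repeated
doubling.\<close>
definition halving_coeff :: "nat \<Rightarrow> nat \<Rightarrow> nat \<times> nat \<Rightarrow> nat \<times> nat \<Rightarrow> 'a::comm_ring_1" where
  "halving_coeff k r p q =
     (if p = q then 1 else if q = (r, r) \<and> fst p = snd p \<and> k \<le> fst p \<and> fst p < r
      then 2 ^ (r - fst p) else 0)"

lemma mem_graph_subspace_halving:
  fixes x :: "nat \<times> nat \<Rightarrow> 'a::comm_ring_1"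
  assumes J: "finite J" "J \<subseteq> I" "(r, r) \<in> J" "\<And>i. (i, i) \<in> J \<Longrightarrow> r \<le> i"
  shows "x \<in> graph_subspace I J (halving_coeff k r) \<longleftrightarrow> x \<in> I \<rightarrow>\<^sub>E UNIV
    \<and> (\<forall>i j. (i, j) \<in> I - J \<longrightarrow> x (i, j) = (if i = j \<and> k \<le> i \<and> i < r then 2 ^ (r - i) * x (r, r) else 0))"
proof -
  have sum: "(\<Sum>q\<in>J. halving_coeff k r (i, j) q * x q) = (if (i, j) \<in> J then x (i, j)
      else if i = j \<and> k \<le> i \<and> i < r then 2 ^ (r - i) * x (r, r) else 0)" for i j
  proof -
    have "(\<Sum>q\<in>J. halving_coeff k r (i, j) q * x q)
        = (\<Sum>q\<in>J. (if q = (i, j) then x (i, j) else 0)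
          + (if q = (r, r) then (if i = j \<and> k \<le> i \<and> i < r then 2 ^ (r - i) * x (r, r) else 0) else 0))"
      by (intro sum.cong) (auto simp: halving_coeff_def)
    also have "\<dots> = (if (i, j) \<in> J then x (i, j) else 0)
          + (if i = j \<and> k \<le> i \<and> i < r then 2 ^ (r - i) * x (r, r) else 0)"
      using J(1,3) by (simp add: sum.distrib)
    finally show ?thesis using J(4)[of i] by auto
  qed
  show ?thesis
    unfolding graph_subspace_def using J(2) by (auto simp: sum)
qed

lemma halving_coeff_kronecker:
  assumes "\<And>i. (i, i) \<in> J \<Longrightarrow> r \<le> i" "p \<in> J" "q \<in> J"
  shows "halving_coeff k r p q = (if p = q then 1 else 0)"
  using assms(1)[of "fst p"] assms(2,3) by (cases p) (auto simp: halving_coeff_def)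

context max_nilindex_normal_form
begin

text \<open>The positions of the free entries: the last row up to column \<open>k\<close>, and the eigenvalue of \<open>e n\<close>, which
coincides with the last of these for \<open>k = n\<close>.\<close>
definition ordinary_params :: "nat \<Rightarrow> (nat \<times> nat) set" where
  "ordinary_params k = {n} \<times> ({1..k} \<union> {n})"

definition local_params :: "(nat \<times> nat) set" where
  "local_params = insert (n - 1, n - 1) ({n} \<times> {1..n})"

lemma ordinary_params:
  assumes "k \<le> n"
  shows "finite (ordinary_params k)" "ordinary_params k \<subseteq> {1..n} \<times> {1..n}"
    "(n, n) \<in> ordinary_params k" "\<And>i. (i, i) \<in> ordinary_params k \<Longrightarrow> n \<le> i"
    "card (ordinary_params k) = (if k < n then k + 1 else n)"
proof -
  show "finite (ordinary_params k)" "ordinary_params k \<subseteq> {1..n} \<times> {1..n}"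
    "(n, n) \<in> ordinary_params k" "\<And>i. (i, i) \<in> ordinary_params k \<Longrightarrow> n \<le> i"
    using assms n_ge_3 by (auto simp: ordinary_params_def)
  show "card (ordinary_params k) = (if k < n then k + 1 else n)"
  proof (cases "k < n")
    case True
    then have "card ({1..k} \<union> {n}) = k + 1" by simp
    then show ?thesis using True by (simp add: ordinary_params_def card_cartesian_product_singleton)
  next
    case False
    then have "{1..k} \<union> {n} = {1..n}" using assms n_ge_3 by auto
    then show ?thesis using False by (simp add: ordinary_params_def card_cartesian_product_singleton)
  qed
qed

lemma local_params:
  "finite local_params" "local_params \<subseteq> {1..n} \<times> {1..n}" "(n - 1, n - 1) \<in> local_params"
  "\<And>i. (i, i) \<in> local_params \<Longrightarrow> n - 1 \<le> i" "card local_params = n + 1"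
proof -
  show "finite local_params" "local_params \<subseteq> {1..n} \<times> {1..n}" "(n - 1, n - 1) \<in> local_params"
    "\<And>i. (i, i) \<in> local_params \<Longrightarrow> n - 1 \<le> i"
    using n_ge_3 by (auto simp: local_params_def)
  have "(n - 1, n - 1) \<notin> {n} \<times> {1..n}" using n_ge_3 by auto
  then show "card local_params = n + 1"
    by (simp add: local_params_def card_cartesian_product_singleton)
qed

lemma ordinary_shape_iff_matrix:
  assumes "k \<le> n"
  shows "ordinary_shape k T \<longleftrightarrow> matrix_entries scale n e T
    \<in> graph_subspace ({1..n} \<times> {1..n}) (ordinary_params k) (halving_coeff k n)"
proof -
  have "ordinary_shape k T \<longleftrightarrow> (\<forall>i j. (i, j) \<in> {1..n} \<times> {1..n} - ordinary_params k \<longrightarrow>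
      coord i (T (e j)) = (if i = j \<and> k \<le> i \<and> i < n then 2 ^ (n - i) * coord n (T (e n)) else 0))"
    (is "_ \<longleftrightarrow> ?R")
  proof
    assume shape: "ordinary_shape k T"
    show ?R
    proof (intro allI impI)
      fix i j assume "(i, j) \<in> {1..n} \<times> {1..n} - ordinary_params k"
      then show "coord i (T (e j))
          = (if i = j \<and> k \<le> i \<and> i < n then 2 ^ (n - i) * coord n (T (e n)) else 0)"
        using shape by (cases "i = n") (auto simp: ordinary_shape_def ordinary_params_def)
    qed
  next
    assume R: ?R
    show "ordinary_shape k T"
      unfolding ordinary_shape_def
    proof (intro conjI ballI allI impI)
      fix i j assume "i \<in> {1..<n}" "j \<in> {1..n}"
      then show "coord i (T (e j)) = (if i = j \<and> k \<le> i then 2 ^ (n - i) * coord n (T (e n)) else 0)"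
        using R[rule_format, of i j] by (auto simp: ordinary_params_def)
    next
      fix j assume "k < j \<and> j < n"
      then show "coord n (T (e j)) = 0"
        using R[rule_format, of n j] by (auto simp: ordinary_params_def)
    qed
  qed
  also have "\<dots> \<longleftrightarrow> matrix_entries scale n e T \<in> {1..n} \<times> {1..n} \<rightarrow>\<^sub>E UNIV
      \<and> (\<forall>i j. (i, j) \<in> {1..n} \<times> {1..n} - ordinary_params k \<longrightarrow> matrix_entries scale n e T (i, j)
        = (if i = j \<and> k \<le> i \<and> i < n then 2 ^ (n - i) * matrix_entries scale n e T (n, n) else 0))"
  proof -
    have "matrix_entries scale n e T (n, n) = coord n (T (e n))"
      using n_ge_3 by (intro matrix_entries_eq) auto
    moreover have "matrix_entries scale n e T (i, j) = coord i (T (e j))"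
      if "(i, j) \<in> {1..n} \<times> {1..n} - ordinary_params k" for i j
      using that by (intro matrix_entries_eq) auto
    ultimately show ?thesis using matrix_entries_extensional[of T] by simp
  qed
  also have "\<dots> \<longleftrightarrow> matrix_entries scale n e T
      \<in> graph_subspace ({1..n} \<times> {1..n}) (ordinary_params k) (halving_coeff k n)"
    by (rule mem_graph_subspace_halving[symmetric]) (fact ordinary_params[OF assms])+
  finally show ?thesis .
qed

lemma local_shape_iff_matrix:
  "local_shape k T \<longleftrightarrow> matrix_entries scale n e T
    \<in> graph_subspace ({1..n} \<times> {1..n}) local_params (halving_coeff k (n - 1))"
  if "k \<le> n - 1"
proof -
  have "local_shape k T \<longleftrightarrow> (\<forall>i j. (i, j) \<in> {1..n} \<times> {1..n} - local_params \<longrightarrow>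
      coord i (T (e j)) = (if i = j \<and> k \<le> i \<and> i < n - 1
        then 2 ^ (n - 1 - i) * coord (n - 1) (T (e (n - 1))) else 0))"
    (is "_ \<longleftrightarrow> ?R")
  proof
    assume shape: "local_shape k T"
    show ?R
    proof (intro allI impI)
      fix i j assume ij: "(i, j) \<in> {1..n} \<times> {1..n} - local_params"
      then have "i \<in> {1..<n}" "j \<in> {1..n}" by (auto simp: local_params_def)
      then have "coord i (T (e j)) = (if i = j \<and> k \<le> i
          then 2 ^ (n - 1 - i) * coord (n - 1) (T (e (n - 1))) else 0)"
        using shape unfolding local_shape_def by blast
      moreover have "i < n - 1" if "i = j"
        using ij that by (auto simp: local_params_def)
      ultimately show "coord i (T (e j)) = (if i = j \<and> k \<le> i \<and> i < n - 1
          then 2 ^ (n - 1 - i) * coord (n - 1) (T (e (n - 1))) else 0)"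
        by (cases "i = j") simp_all
    qed
  next
    assume R: ?R
    show "local_shape k T"
      unfolding local_shape_def
    proof (intro ballI)
      fix i j assume "i \<in> {1..<n}" "j \<in> {1..n}"
      then show "coord i (T (e j)) = (if i = j \<and> k \<le> i
          then 2 ^ (n - 1 - i) * coord (n - 1) (T (e (n - 1))) else 0)"
        using R[rule_format, of i j] that
        by (cases "(i, j) = (n - 1, n - 1)") (auto simp: local_params_def)
    qed
  qed
  also have "\<dots> \<longleftrightarrow> matrix_entries scale n e T \<in> {1..n} \<times> {1..n} \<rightarrow>\<^sub>E UNIV
      \<and> (\<forall>i j. (i, j) \<in> {1..n} \<times> {1..n} - local_params \<longrightarrow> matrix_entries scale n e T (i, j)
        = (if i = j \<and> k \<le> i \<and> i < n - 1 then 2 ^ (n - 1 - i) * matrix_entries scale n e T (n - 1, n - 1) else 0))"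
  proof -
    have "matrix_entries scale n e T (n - 1, n - 1) = coord (n - 1) (T (e (n - 1)))"
      using n_ge_3 by (intro matrix_entries_eq) auto
    moreover have "matrix_entries scale n e T (i, j) = coord i (T (e j))"
      if "(i, j) \<in> {1..n} \<times> {1..n} - local_params" for i j
      using that by (intro matrix_entries_eq) auto
    ultimately show ?thesis using matrix_entries_extensional[of T] by simp
  qed
  also have "\<dots> \<longleftrightarrow> matrix_entries scale n e T
      \<in> graph_subspace ({1..n} \<times> {1..n}) local_params (halving_coeff k (n - 1))"
    by (rule mem_graph_subspace_halving[symmetric]) (fact local_params)+
  finally show ?thesis .
qed

text \<open>The dimension \<open>n\<close> is attained for the shape \<open>n\<close>, that is by \<open>V0\<close>, and by \<open>W (n - 1)\<close>.\<close>
lemma zariski_dim_RB0: "zariski_dim scale n e (RB0 scale mul) = enat n"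
proof -
  let ?K = "{obstruction_index n a + 1..n}"
  let ?G = "\<lambda>k. graph_subspace ({1..n} \<times> {1..n}) (ordinary_params k) (halving_coeff k n)
    :: (nat \<times> nat \<Rightarrow> 'a) set"
  have "matrix_entries scale n e ` RB0 scale mul = (\<Union>k\<in>?K. ?G k)"
    by (rule matrix_entries_image)
      (auto simp: RB0_iff_ordinary_shape ordinary_shape_iff_matrix graph_subspace_def)
  moreover have "krull_dim (subtopology (zariski ({1..n} \<times> {1..n})) (\<Union>k\<in>?K. ?G k)) = enat n"
  proof (rule krull_dim_finite_Union_graph_subspaces[where b = "\<lambda>k. halving_coeff k n"
        and J = ordinary_params and ?k0.0 = n])
    show "n \<in> ?K" using obstruction_index_less by simp
    show "halving_coeff k n i j = (if i = j then 1 else 0)"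
      if "k \<in> ?K" "i \<in> ordinary_params k" "j \<in> ordinary_params k" for k i j
      using that by (intro halving_coeff_kronecker[OF ordinary_params(4)]) auto
  qed (use ordinary_params in auto)
  ultimately show ?thesis by (simp add: zariski_dim_def)
qed

lemma zariski_dim_LRB0: "zariski_dim scale n e (LRB0 scale mul) = enat (n + 1)"
proof -
  let ?K = "{obstruction_index n a + 1..n - 1}"
  let ?G = "\<lambda>k. graph_subspace ({1..n} \<times> {1..n}) local_params (halving_coeff k (n - 1))
    :: (nat \<times> nat \<Rightarrow> 'a) set"
  have "matrix_entries scale n e ` LRB0 scale mul = (\<Union>k\<in>?K. ?G k)"
    by (rule matrix_entries_image)
      (auto simp: LRB0_iff_local_shape local_shape_iff_matrix graph_subspace_def)
  moreover have "krull_dim (subtopology (zariski ({1..n} \<times> {1..n})) (\<Union>k\<in>?K. ?G k)) = enat (n + 1)"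
  proof (rule krull_dim_finite_Union_graph_subspaces[where b = "\<lambda>k. halving_coeff k (n - 1)"
        and J = "\<lambda>_. local_params" and ?k0.0 = "n - 1"])
    show "n - 1 \<in> ?K" using obstruction_index_less by simp
    show "halving_coeff k (n - 1) i j = (if i = j then 1 else 0)"
      if "i \<in> local_params" "j \<in> local_params" for k i j
      using that by (intro halving_coeff_kronecker[OF local_params(4)])
  qed (use local_params in auto)
  ultimately show ?thesis by (simp add: zariski_dim_def)
qed

end

theorem corollary5p3:
  fixes scale :: "'a::field_char_0 \<Rightarrow> 'v::ab_group_add \<Rightarrow> 'v"
    and mul :: "'v \<Rightarrow> 'v \<Rightarrow> 'v"
    and n i0 :: nat
    and e :: "nat \<Rightarrow> 'v"
    and a :: "nat \<Rightarrow> nat \<Rightarrow> 'a"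
  assumes normal_form: "max_nilindex_normal_form scale mul n e a"
    and i0: "i0 = obstruction_index n a"
  shows "RB0 scale mul = V0 scale n e \<union> (\<Union>k\<in>{i0 + 1..n - 1}. W scale n e k)
    \<and> V0 scale n e \<inter> (\<Union>k\<in>{i0 + 1..n - 1}. W scale n e k) = {}
    \<and> RB0 scale mul \<subseteq> LRB0 scale mul
    \<and> zariski_dim scale n e (RB0 scale mul)
        = enat (Max (insert n {k + 1 | k. i0 + 1 \<le> k \<and> k \<le> n - 1}))
    \<and> Max (insert n {k + 1 | k. i0 + 1 \<le> k \<and> k \<le> n - 1}) = n
    \<and> zariski_dim scale n e (LRB0 scale mul) = enat (n + 1)
    \<and> zariski_dim scale n e (LRB0 scale mul) = zariski_dim scale n e (RB0 scale mul) + 1"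
proof -
  interpret max_nilindex_normal_form scale mul n e a by (rule normal_form)
  have max: "Max (insert n {k + 1 | k. i0 + 1 \<le> k \<and> k \<le> n - 1}) = n"
  proof (rule Max_eqI)
    show "finite (insert n {k + 1 | k. i0 + 1 \<le> k \<and> k \<le> n - 1})"
      by (rule finite_subset[of _ "{..n + 1}"]) auto
  qed (use n_ge_3 in auto)
  have disjoint: "V0 scale n e \<inter> (\<Union>k\<in>{i0 + 1..n - 1}. W scale n e k) = {}"
  proof -
    have "V0 scale n e \<inter> W scale n e k = {}" if "k \<in> {i0 + 1..n - 1}" for k
      using that n_ge_3 by (intro V0_W_disjoint) auto
    then show ?thesis by blast
  qed
  have "RB0 scale mul \<subseteq> LRB0 scale mul" by (auto simp: RB0_def LRB0_def)
  then show ?thesis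
    using RB0_eq_V0_union_W disjoint max zariski_dim_RB0 zariski_dim_LRB0
    by (simp add: i0 eSuc_enat plus_1_eSuc one_enat_def)
qed

end
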